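(* Consider either (a) covariance (in particular correlation) matrix completion: $\mathbb{S}^n$ is the real symmetric or Hermitian $n\times n$ matrices with the entry basis described below, $\alpha$ indexes a set of diagonal basis elements $\{e_ie_i^{\mathbb{T}}:i\in I\}$, and $\overline X$ is positive semidefinite with $\overline X_{ii}>0$ for $i\in I$; or (b) density matrix completion: $\mathbb{S}^n$ is the Hermitian $n\times n$ matrices, the orthonormal basis contains $\frac1{\sqrt n}I_n$, $\alpha$ indexes exactly this element, and $\overline X$ is positive semidefinite with $\mathrm{Tr}(\overline X)=1$. Assume uniform sampling ($p_k=1/d_2$ for all $k\in\beta$), $\rho_m\to0$, $\sqrt m\,\rho_m\to\infty$, $\gamma_m=O_p(1)$, and that $F$ is the spectral operator associated with a symmetric function $f:\mathbb{R}^n\to\mathbb{R}^n$ such that for each $i=1,\dots,n$: $f_i(x)\ge0$ for all $x\in\mathbb{R}^n_+$, and $f_i(x)=0$ if and only if $x_i=0$. Then the estimator $\widehat X_m$ from problem (RC+) is rank consistent, i.e., $\lim_{m\to\infty}\Pr(\mathrm{rank}(\widehat X_m)=\mathrm{rank}(\overline X))=1$.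
   Context: $\langle X,Y\rangle=\mathrm{Re}\,\mathrm{Tr}(X^{\mathbb{T}}Y)$ with $^{\mathbb{T}}$ transpose or conjugate transpose; $\|\cdot\|_F$ is the Frobenius norm; $e_i$ is the $i$-th unit vector. In case (a) the orthonormal basis is $\{e_ie_i^{\mathbb{T}}\}_{1\le i\le n}\cup\{\frac1{\sqrt2}(e_ie_j^{\mathbb{T}}+e_je_i^{\mathbb{T}})\}_{i<j}$ (real) or additionally with $\{\frac{\sqrt{-1}}{\sqrt2}(e_ie_j^{\mathbb{T}}-e_je_i^{\mathbb{T}})\}_{i<j}$ (complex). Generally $\{\Theta_1,\dots,\Theta_d\}$ denotes the orthonormal basis, $\beta=\{1,\dots,d\}\setminus\alpha$, $d_2=|\beta|$, $\mathcal{R}_\pi(X)=(\langle\Theta_k,X\rangle)_{k\in\pi}$. $\overline X$ has rank $r\ge1$. Observations: $\omega_1,\dots,\omega_m$ i.i.d. uniform on $\beta$; $\xi_i$ i.i.d., independent of the $\omega_i$, $\mathbb{E}\xi_i=0$, $\mathbb{E}\xi_i^2=1$; $\nu>0$; $y_i=\langle\Theta_{\omega_i},\overline X\rangle+\nu\xi_i$; $\mathcal{R}_\Omega(X)=(\langle\Theta_{\omega_i},X\rangle)_{i=1}^m$. $f$ symmetric means $f(x)=Q^{\mathbb{T}}f(Qx)$ for all signed permutation matrices $Q$; for positive semidefinite $X=P\mathrm{Diag}(\lambda(X))P^{\mathbb{T}}$, $F(X)=P\mathrm{Diag}(f(\lambda(X)))P^{\mathbb{T}}$. Problem (RC+): given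 a positive semidefinite initial estimator $\widetilde X_m$, $\rho_m>0$, $\gamma_m\ge0$, $\widehat X_m$ is an optimal solution of $\min_{X\in\mathbb{S}^n}\frac1{2m}\|y-\mathcal{R}_\Omega(X)\|_2^2+\rho_m(\langle I_n-F(\widetilde X_m),X\rangle+\frac{\gamma_m}2\|X-\widetilde X_m\|_F^2)$ s.t. $\mathcal{R}_\alpha(X)=\mathcal{R}_\alpha(\overline X)$, $X$ positive semidefinite. Standing assumptions: $n$ fixed, $m\to\infty$; $F$ continuous at $\overline X$; $\widetilde X_m\xrightarrow{p}\overline X$. *)

theory Defs
  imports "HOL-Probability.Probability"
begin

(* Matrices are complex n x n matrices indexed by a finite linearly ordered type 'n.
   The real symmetric case is modelled as Hermitian matrices with real entries. *)

type_synonym 'n cmat = "complex^'n^'n"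

definition adj :: "'n::finite cmat \<Rightarrow> 'n cmat" where
  "adj A = (\<chi> i j. cnj (A $ j $ i))"

definition hermitian :: "'n::finite cmat \<Rightarrow> bool" where
  "hermitian A \<longleftrightarrow> adj A = A"

definition real_mat :: "'n::finite cmat \<Rightarrow> bool" where
  "real_mat A \<longleftrightarrow> (\<forall>i j. Im (A $ i $ j) = 0)"

definition Sn :: "bool \<Rightarrow> 'n::finite cmat set" where
  "Sn realcase = {X. hermitian X \<and> (realcase \<longrightarrow> real_mat X)}"

definition psd :: "'n::finite cmat \<Rightarrow> bool" where
  "psd A \<longleftrightarrow> hermitian A \<and> (\<forall>x::complex^'n. Re (\<Sum>i\<in>UNIV. cnj (x $ i) * (A *v x) $ i) \<ge> 0)"


definition ip :: "'n::finite cmat \<Rightarrow> 'n cmat \<Rightarrow> real" where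
  "ip X Y = Re (trace (adj X ** Y))"

definition frob :: "'n::finite cmat \<Rightarrow> real" where
  "frob X = sqrt (ip X X)"

definition unitary :: "'n::finite cmat \<Rightarrow> bool" where
  "unitary P \<longleftrightarrow> adj P ** P = mat 1"

definition Diag :: "real^'n::finite \<Rightarrow> 'n cmat" where
  "Diag v = (\<chi> i j. if i = j then complex_of_real (v $ i) else 0)"

definition unitmat :: "'n::finite \<Rightarrow> 'n \<Rightarrow> 'n cmat" where
  "unitmat i j = (\<chi> a b. if a = i \<and> b = j then 1 else 0)"

definition signed_perm_mat :: "real^'n::finite^'n \<Rightarrow> bool" where
  "signed_perm_mat Q \<longleftrightarrow> (\<exists>\<pi> s. bij \<pi> \<and> (\<forall>i. s i = 1 \<or> s i = -1) \<and>
      Q = (\<chi> i j. if j = \<pi> i then s i else 0))"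

definition symmetric_fun :: "(real^'n::finite \<Rightarrow> real^'n) \<Rightarrow> bool" where
  "symmetric_fun f \<longleftrightarrow> (\<forall>Q x. signed_perm_mat Q \<longrightarrow> f x = transpose Q *v f (Q *v x))"

text \<open>Spectral operator: for X = P Diag(lambda) P^*, F(X) = P Diag(f(lambda)) P^*.
  For symmetric f this does not depend on the chosen decomposition.\<close>
definition spectral_op :: "(real^'n \<Rightarrow> real^'n) \<Rightarrow> 'n::finite cmat \<Rightarrow> 'n cmat" where
  "spectral_op f X = (SOME Y. \<exists>P lam. unitary P \<and> X = P ** Diag lam ** adj P \<and>
                                   Y = P ** Diag (f lam) ** adj P)"

definition orthonormal_basis :: "bool \<Rightarrow> (nat \<Rightarrow> 'n::finite cmat) \<Rightarrow> nat \<Rightarrow> bool" where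
  "orthonormal_basis realcase \<Theta> d \<longleftrightarrow>
     (\<forall>k\<in>{1..d}. \<Theta> k \<in> Sn realcase) \<and>
     (\<forall>j\<in>{1..d}. \<forall>k\<in>{1..d}. ip (\<Theta> j) (\<Theta> k) = (if j = k then 1 else 0)) \<and>
     (\<forall>X\<in>Sn realcase. X = (\<Sum>k\<in>{1..d}. ip (\<Theta> k) X *\<^sub>R \<Theta> k))"

definition entry_basis :: "bool \<Rightarrow> 'n::{finite,linorder} cmat set" where
  "entry_basis realcase =
     {unitmat i i | i. True}
     \<union> {(1 / sqrt 2) *\<^sub>R (unitmat i j + unitmat j i) | i j. i < j}
     \<union> (if realcase then {}
        else {(\<chi> a b. (\<i> / complex_of_real (sqrt 2)) * (unitmat i j - unitmat j i) $ a $ b) | i j. i < j})"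

definition bounded_in_prob :: "'a measure \<Rightarrow> (nat \<Rightarrow> 'a \<Rightarrow> real) \<Rightarrow> bool" where
  "bounded_in_prob M g \<longleftrightarrow>
     (\<forall>\<epsilon>>0. \<exists>K N. \<forall>m\<ge>N. measure M {x\<in>space M. \<bar>g m x\<bar> > K} < \<epsilon>)"

definition conv_in_prob :: "'a measure \<Rightarrow> (nat \<Rightarrow> 'a \<Rightarrow> 'n::finite cmat) \<Rightarrow> 'n cmat \<Rightarrow> bool" where
  "conv_in_prob M Z L \<longleftrightarrow>
     (\<forall>\<epsilon>>0. (\<lambda>m. measure M {x\<in>space M. frob (Z m x - L) > \<epsilon>}) \<longlonglongrightarrow> 0)"

definition rc_objective ::
  "(nat \<Rightarrow> 'n::finite cmat) \<Rightarrow> 'n cmat \<Rightarrow> real \<Rightarrow> (nat \<Rightarrow> nat) \<Rightarrow> (nat \<Rightarrow> real) \<Rightarrow> nat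
    \<Rightarrow> real \<Rightarrow> real \<Rightarrow> 'n cmat \<Rightarrow> 'n cmat \<Rightarrow> 'n cmat \<Rightarrow> real" where
  "rc_objective \<Theta> Xbar \<nu> \<omega> \<xi> m \<rho> \<gamma> Xt FXt X =
     1 / (2 * real m) * (\<Sum>i\<in>{1..m}. ((ip (\<Theta> (\<omega> i)) Xbar + \<nu> * \<xi> i) - ip (\<Theta> (\<omega> i)) X)\<^sup>2)
     + \<rho> * (ip (mat 1 - FXt) X + \<gamma> / 2 * (frob (X - Xt))\<^sup>2)"

definition rc_feasible :: "bool \<Rightarrow> (nat \<Rightarrow> 'n::finite cmat) \<Rightarrow> nat set \<Rightarrow> 'n cmat \<Rightarrow> 'n cmat set" where
  "rc_feasible realcase \<Theta> \<alpha> Xbar =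
     {X \<in> Sn realcase. psd X \<and> (\<forall>k\<in>\<alpha>. ip (\<Theta> k) X = ip (\<Theta> k) Xbar)}"

definition families_indep :: "'a measure \<Rightarrow> (nat \<Rightarrow> 'a \<Rightarrow> nat) \<Rightarrow> (nat \<Rightarrow> 'a \<Rightarrow> real) \<Rightarrow> bool" where
  "families_indep M \<omega> \<xi> \<longleftrightarrow> prob_space.indep_set M
     (sigma_sets (space M) {\<omega> i -` A \<inter> space M | i A. True})
     (sigma_sets (space M) {\<xi> i -` B \<inter> space M | i B. B \<in> sets borel})"

definition is_opt :: "('b \<Rightarrow> real) \<Rightarrow> 'b set \<Rightarrow> 'b \<Rightarrow> bool" where
  "is_opt h C z \<longleftrightarrow> z \<in> C \<and> (\<forall>X\<in>C. h z \<le> h X)"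

end

theory Submission
  imports Defs
begin

text \<open>
  The usual route through the Karush--Kuhn--Tucker conditions and epi-convergence is replaced by a
  comparison with one explicit feasible direction. Moving from the estimator \<open>X\<close> towards \<open>Xbar\<close> gives
  \<open>norm (X - Xbar) = O(\<rho>)\<close>, so \<open>rank X \<ge> rank Xbar\<close> by lower semicontinuity of the rank. If the
  inequality were strict, there would be a vector \<open>v \<noteq> 0\<close> in the range of \<open>X\<close> and in the kernel of
  \<open>Xbar\<close>. Then \<open>X - t v v\<^sup>*\<close> is positive semidefinite for small \<open>t > 0\<close>, and the fixed coefficients are
  restored by adding \<open>t C\<close> with \<open>C = Diag (|v_i|\<^sup>2, i \<in> I)\<close> in case (a) and \<open>C = (|v|\<^sup>2 / n) I\<close> in case (b).
  Along \<open>D = C - v v\<^sup>*\<close> the quadratic loss has nonpositive slope up to \<open>o(\<rho>)\<close>, because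
  \<open>\<langle>X - Xbar, D\<rangle> = - v\<^sup>* X v \<le> 0\<close>, while the penalty has slope at most \<open>- \<rho> \<delta> |v|\<^sup>2\<close>, because \<open>F(Xbar) v = 0\<close>
  and the relevant diagonal entries (or the trace) of \<open>F(Xbar)\<close> are positive. This contradicts
  optimality whenever the sampling frequencies, the averaged noise and the initial estimator are
  close to their limits, which Chebyshev's inequality makes likely.
\<close>

section \<open>Hermitian matrices and the spectral theorem\<close>

text \<open>Identifies the Frobenius product with the Euclidean inner product of the matrix type, so
  that its norm, Cauchy-Schwarz and limits become available.\<close>

lemma ip_eq_inner: "ip X Y = X \<bullet> Y"
proof -
  have "ip X Y = (\<Sum>j\<in>UNIV. \<Sum>i\<in>UNIV. Re (cnj (X $ i $ j) * Y $ i $ j))"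
    by (simp add: ip_def trace_def matrix_matrix_mult_def adj_def)
  also have "\<dots> = (\<Sum>i\<in>UNIV. \<Sum>j\<in>UNIV. Re (cnj (X $ i $ j) * Y $ i $ j))"
    by (rule sum.swap)
  also have "\<dots> = X \<bullet> Y"
    by (simp add: inner_vec_def inner_complex_def)
  finally show ?thesis .
qed

lemma frob_eq_norm: "frob X = norm X"
  by (simp add: frob_def ip_eq_inner norm_eq_sqrt_inner)

text \<open>On complex vectors \<open>\<bullet>\<close> is only the real part of the Hermitian
  product, while orthogonality of eigenvectors needs the full complex value. The form is
  conjugate-linear in its first argument.\<close>

definition csp :: "complex^'n::finite \<Rightarrow> complex^'n \<Rightarrow> complex" where
  "csp x y = (\<Sum>i\<in>UNIV. cnj (x $ i) * y $ i)"

lemma Re_csp: "Re (csp x y) = x \<bullet> y"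
  by (simp add: csp_def inner_vec_def inner_complex_def)

lemma csp_simps:
  "csp x (y + z) = csp x y + csp x z" "csp x (y - z) = csp x y - csp x z"
  "csp x (c *s y) = c * csp x y" "csp (c *s x) y = cnj c * csp x y"
  by (simp_all add: csp_def sum.distrib sum_subtractf sum_distrib_left algebra_simps)

lemma csp_commute: "csp y x = cnj (csp x y)"
  by (simp add: csp_def mult.commute)

lemma csp_self: "csp x x = complex_of_real ((norm x)\<^sup>2)"
  by (rule complex_eqI) (simp_all add: Re_csp power2_norm_eq_inner, simp add: csp_def)

lemma csp_adj: "csp (adj A *v x) y = csp x (A *v y)"
proof -
  have "csp (adj A *v x) y = (\<Sum>i\<in>UNIV. \<Sum>j\<in>UNIV. A $ j $ i * cnj (x $ j) * y $ i)"
    by (simp add: csp_def matrix_vector_mult_def adj_def sum_distrib_right)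
  also have "\<dots> = (\<Sum>j\<in>UNIV. \<Sum>i\<in>UNIV. A $ j $ i * cnj (x $ j) * y $ i)"
    by (rule sum.swap)
  also have "\<dots> = csp x (A *v y)"
    by (simp add: csp_def matrix_vector_mult_def sum_distrib_left algebra_simps)
  finally show ?thesis .
qed

lemma hermitian_csp: "hermitian A \<Longrightarrow> csp (A *v x) y = csp x (A *v y)"
  by (metis csp_adj hermitian_def)

lemma hermitian_inner: "hermitian A \<Longrightarrow> (A *v x) \<bullet> y = x \<bullet> (A *v y)"
  by (metis Re_csp hermitian_csp)

lemma psd_iff: "psd A \<longleftrightarrow> hermitian A \<and> (\<forall>x. 0 \<le> x \<bullet> (A *v x))"
  by (simp add: psd_def Re_csp[symmetric] csp_def)

lemma hermitian_nth: "hermitian A \<Longrightarrow> A $ i $ j = cnj (A $ j $ i)"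
  by (auto simp: hermitian_def adj_def vec_eq_iff)

lemma hermitianI: "(\<And>i j. A $ i $ j = cnj (A $ j $ i)) \<Longrightarrow> hermitian A"
  unfolding hermitian_def adj_def vec_eq_iff vec_lambda_beta by metis

lemma hermitian_comb:
  assumes "hermitian A" "hermitian B" shows "hermitian (a *\<^sub>R A + b *\<^sub>R B)"
proof (rule hermitianI)
  show "(a *\<^sub>R A + b *\<^sub>R B) $ i $ j = cnj ((a *\<^sub>R A + b *\<^sub>R B) $ j $ i)" for i j
    using hermitian_nth[OF assms(1), of i j] hermitian_nth[OF assms(2), of i j] by simp
qed

lemma matrix_vector_comb:
  fixes A B :: "'n::finite cmat"
  shows "(a *\<^sub>R A + b *\<^sub>R B) *v x = a *\<^sub>R (A *v x) + b *\<^sub>R (B *v x)"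
  by (simp add: vec_eq_iff matrix_vector_mult_def sum.distrib scaleR_sum_right algebra_simps)

lemma scaleR_vec_eq_smult: "c *\<^sub>R (x::complex^'n) = complex_of_real c *s x"
  by (simp add: vec_eq_iff) (simp add: scaleR_conv_of_real)

lemma matrix_vector_scaleR: "A *v (c *\<^sub>R (x::complex^'n)) = c *\<^sub>R (A *v x)"
  by (simp add: scaleR_vec_eq_smult vec.scale)

lemma continuous_on_matrix_vector: "continuous_on S (\<lambda>x. A *v (x::complex^'n))"
  unfolding matrix_vector_mult_def by (intro continuous_intros)

text \<open>If \<open>b\<close> were positive, a positive \<open>t\<close> with
  \<open>t * C \<le> b\<close> would give \<open>2 * b \<le> b\<close>. This is the first-order
  condition at a maximum of a quadratic form, with \<open>b\<close> the squared length of the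
  residual.\<close>

lemma quadratic_max_residual_zero:
  fixes b C :: real
  assumes "\<And>t. 2 * t * b \<le> t\<^sup>2 * C" and "b \<ge> 0"
  shows "b = 0"
proof (rule ccontr)
  assume "b \<noteq> 0"
  then have b: "b > 0" using assms(2) by simp
  let ?t = "b / (\<bar>C\<bar> + 1)"
  have "2 * b \<le> ?t * C"
  proof -
    have "?t > 0" using b by simp
    moreover have "?t * (2 * b) \<le> ?t * (?t * C)"
      using assms(1)[of ?t] by (simp only: power2_eq_square mult.assoc mult.commute mult.left_commute)
    ultimately show ?thesis using mult_le_cancel_left_pos by blast
  qed
  also have "\<dots> \<le> b"
  proof -
    have "b * C \<le> b * (\<bar>C\<bar> + 1)" using b by (intro mult_left_mono) auto
    then show ?thesis by (simp add: divide_le_eq)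
  qed
  finally show False using b by simp
qed

text \<open>Maximise the Rayleigh quotient over the compact unit sphere of \<open>U\<close>. The
  residual \<open>w = A *v x - l *\<^sub>R x\<close> lies in \<open>U\<close> and is orthogonal to
  \<open>x\<close>, so moving \<open>x\<close> along \<open>w\<close> would increase the quotient to
  first order unless \<open>w = 0\<close>.\<close>

lemma hermitian_eigenvector_in_invariant_subspace:
  fixes A :: "'n::finite cmat" and U :: "(complex^'n) set"
  assumes herm: "hermitian A"
    and add: "\<And>x y. x \<in> U \<Longrightarrow> y \<in> U \<Longrightarrow> x + y \<in> U"
    and scale: "\<And>c x. x \<in> U \<Longrightarrow> c *\<^sub>R x \<in> U"
    and closed: "closed U" and inv: "\<And>x. x \<in> U \<Longrightarrow> A *v x \<in> U"
    and ne: "y \<in> U" "y \<noteq> 0"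
  shows "\<exists>x l. x \<in> U \<and> norm x = 1 \<and> A *v x = l *\<^sub>R x"
proof -
  let ?q = "\<lambda>x. x \<bullet> (A *v x)"
  have "compact (U \<inter> sphere 0 1)" using closed by (simp add: closed_Int_compact)
  moreover have "(1 / norm y) *\<^sub>R y \<in> U \<inter> sphere 0 1" using ne scale by simp
  moreover have "continuous_on (U \<inter> sphere 0 1) ?q"
    by (intro continuous_intros continuous_on_matrix_vector)
  ultimately obtain x where "x \<in> U \<inter> sphere 0 1" and "\<forall>z\<in>U \<inter> sphere 0 1. ?q z \<le> ?q x"
    using continuous_attains_sup[of "U \<inter> sphere 0 1" ?q] by blast
  then have x: "x \<in> U" "norm x = 1" and max: "\<And>z. z \<in> U \<Longrightarrow> norm z = 1 \<Longrightarrow> ?q z \<le> ?q x"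
    by auto
  define l where "l = ?q x"
  \<comment> \<open>Homogeneity extends the bound from the sphere to all of \<open>U\<close>, which
    spares normalising the perturbed vector.\<close>
  have max': "?q z \<le> l * (norm z)\<^sup>2" if "z \<in> U" for z
  proof (cases "z = 0")
    case False
    have "?q ((1 / norm z) *\<^sub>R z) \<le> l"
      unfolding l_def using False that scale by (intro max) auto
    then show ?thesis using False by (simp add: matrix_vector_scaleR power2_eq_square divide_simps)
  qed simp
  define w where "w = A *v x + (- l) *\<^sub>R x"
  have wU: "w \<in> U" unfolding w_def by (intro add inv scale x)
  have xx: "x \<bullet> x = 1" using x(2) by (simp add: norm_eq_1)
  have xw: "x \<bullet> w = 0" by (simp add: w_def inner_add_right inner_diff_right l_def xx)
  have wAx: "w \<bullet> (A *v x) = w \<bullet> w"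
  proof -
    have "A *v x = w + l *\<^sub>R x" by (simp add: w_def)
    then show ?thesis using xw by (simp add: inner_add_right inner_commute)
  qed
  have "w \<bullet> w = 0"
  proof (rule quadratic_max_residual_zero)
    fix t :: real
    have "?q (x + t *\<^sub>R w) \<le> l * (norm (x + t *\<^sub>R w))\<^sup>2"
      by (intro max' add scale x wU)
    moreover have "?q (x + t *\<^sub>R w) = l + 2 * t * (w \<bullet> w) + t\<^sup>2 * ?q w"
      using hermitian_inner[OF herm, of x w] wAx
      by (simp add: matrix_vector_right_distrib matrix_vector_scaleR inner_add_left inner_add_right
          l_def power2_eq_square inner_commute algebra_simps)
    moreover have "(norm (x + t *\<^sub>R w))\<^sup>2 = 1 + t\<^sup>2 * (w \<bullet> w)"
      using xw xx
      by (simp only: power2_norm_eq_inner)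
        (simp add: inner_add_left inner_add_right inner_commute power2_eq_square)
    ultimately show "2 * t * (w \<bullet> w) \<le> t\<^sup>2 * (l * (w \<bullet> w) - ?q w)"
      by (simp add: algebra_simps)
  qed simp
  then have "A *v x = l *\<^sub>R x" by (simp add: w_def)
  then show ?thesis using x by blast
qed

lemma closed_csp_zero: "closed {x. csp e x = 0}"
  unfolding csp_def by (intro closed_Collect_eq continuous_intros)

text \<open>The next eigenvector is sought in the complex orthogonal complement \<open>U\<close> of
  the earlier ones, which the Hermitian \<open>A\<close> maps into itself because the earlier ones
  are eigenvectors.\<close>

lemma hermitian_orthonormal_eigenvectors:
  fixes A :: "'n::finite cmat" and J :: "'n set"
  assumes herm: "hermitian A" and "finite J"
  shows "\<exists>e l. \<forall>j\<in>J. A *v e j = (l j::real) *\<^sub>R e j \<and> (\<forall>i\<in>J. csp (e i) (e j) = (if i = j then 1 else 0))"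
  using \<open>finite J\<close>
proof (induction J rule: finite_induct)
  case empty
  then show ?case by simp
next
  case (insert k J)
  then obtain e l where el: "\<And>j. j \<in> J \<Longrightarrow> A *v e j = (l j::real) *\<^sub>R e j"
    "\<And>i j. i \<in> J \<Longrightarrow> j \<in> J \<Longrightarrow> csp (e i) (e j) = (if i = j then 1 else 0)" by blast
  define U where "U = (\<Inter>j\<in>J. {x. csp (e j) x = 0})"
  \<comment> \<open>The rows of \<open>B\<close> are the conjugated earlier eigenvectors, and row
    \<open>k\<close> is zero because \<open>k\<close> is new. So \<open>B\<close> is singular, and a
    kernel vector is a nonzero element of \<open>U\<close>.\<close>
  define B :: "'n cmat" where "B = (\<chi> i j. if i \<in> J then cnj (e i $ j) else 0)"
  have "row k B = 0" using insert by (simp add: B_def row_def vec_eq_iff)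
  then have "\<not> invertible B" using det_zero_row(2)[of k B] by (simp add: invertible_det_nz)
  then obtain y where y: "y \<noteq> 0" "B *v y = 0"
    by (metis invertible_left_inverse matrix_left_invertible_ker)
  have yU: "y \<in> U"
    unfolding U_def
  proof safe
    fix j assume "j \<in> J"
    then have "csp (e j) y = (B *v y) $ j" by (simp add: csp_def B_def matrix_vector_mult_def)
    then show "csp (e j) y = 0" using y by simp
  qed
  have "\<exists>x m. x \<in> U \<and> norm x = 1 \<and> A *v x = m *\<^sub>R x"
  proof (rule hermitian_eigenvector_in_invariant_subspace[OF herm _ _ _ _ yU y(1)])
    show "closed U" unfolding U_def by (auto intro: closed_csp_zero)
    show "A *v x \<in> U" if "x \<in> U" for x
      using that el(1) unfolding U_def
      by (auto simp: hermitian_csp[OF herm, symmetric] scaleR_vec_eq_smult csp_simps)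
  qed (auto simp: U_def csp_simps scaleR_vec_eq_smult)
  then obtain x m where x: "x \<in> U" "norm x = 1" "A *v x = m *\<^sub>R x" by blast
  have "csp (e j) x = 0" "csp x (e j) = 0" if "j \<in> J" for j
    using that x(1) csp_commute[of x "e j"] by (auto simp: U_def)
  then show ?case
    using el x insert(2) csp_self[of x]
    by (intro exI[of _ "e(k := x)"] exI[of _ "l(k := m)"]) auto
qed

lemma matrix_Diag_nth: "(P ** Diag l) $ a $ j = P $ a $ j * complex_of_real (l $ j)"
proof -
  have "(P ** Diag l) $ a $ j = (\<Sum>k\<in>UNIV. if k = j then P $ a $ k * complex_of_real (l $ k) else 0)"
    unfolding matrix_matrix_mult_def Diag_def vec_lambda_beta by (intro sum.cong) auto
  then show ?thesis by simp
qed

lemma unitary_Diag_nth: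
  "(P ** Diag l ** adj P) $ a $ b = (\<Sum>j\<in>UNIV. P $ a $ j * complex_of_real (l $ j) * cnj (P $ b $ j))"
  by (subst matrix_matrix_mult_def) (simp add: matrix_Diag_nth adj_def)

lemma hermitian_spectral_decomposition:
  fixes A :: "'n::finite cmat"
  assumes herm: "hermitian A"
  shows "\<exists>P l. unitary P \<and> A = P ** Diag l ** adj P"
proof -
  obtain e :: "'n \<Rightarrow> complex^'n" and l where e: "\<And>j. A *v e j = (l j::real) *\<^sub>R e j"
    "\<And>i j. csp (e i) (e j) = (if i = j then 1 else 0)"
    using hermitian_orthonormal_eigenvectors[OF herm finite] by (metis UNIV_I)
  define P :: "'n cmat" where "P = (\<chi> a j. e j $ a)"
  have "(adj P ** P) $ i $ j = mat 1 $ i $ j" for i j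
    using e(2)[of i j] by (simp add: adj_def matrix_matrix_mult_def P_def mat_def csp_def)
  then have u: "adj P ** P = mat 1" by (simp add: vec_eq_iff)
  then have u': "P ** adj P = mat 1" by (simp add: matrix_left_right_inverse)
  have "(A ** P) $ a $ j = (P ** Diag (vec_lambda l)) $ a $ j" for a j
  proof -
    have "(A ** P) $ a $ j = (A *v e j) $ a"
      by (simp add: matrix_matrix_mult_def matrix_vector_mult_def P_def)
    also have "\<dots> = P $ a $ j * l j"
      by (simp only: e(1) vector_scaleR_component P_def vec_lambda_beta)
        (simp add: scaleR_conv_of_real mult.commute)
    also have "\<dots> = (P ** Diag (vec_lambda l)) $ a $ j"
      by (simp add: matrix_Diag_nth)
    finally show ?thesis .
  qed
  then have "A ** P = P ** Diag (vec_lambda l)" by (simp add: vec_eq_iff)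
  then have "A = P ** Diag (vec_lambda l) ** adj P"
    by (metis u' matrix_mul_assoc matrix_mul_rid)
  then show ?thesis using u unitary_def by blast
qed

lemma scaleR_cmat_nth: "(c *\<^sub>R (A::'n::finite cmat)) $ i $ j = complex_of_real c * A $ i $ j"
  by simp (simp add: scaleR_conv_of_real)

text \<open>The spectral theorem makes the choice in \<open>spectral_op\<close> satisfiable, so the
  chosen value comes with some \<open>P\<close> and \<open>l\<close> that diagonalise both matrices
  at once.\<close>

lemma spectral_op_decomposition:
  assumes "hermitian (A::'n::finite cmat)"
  shows "\<exists>P l. unitary P \<and> A = P ** Diag l ** adj P \<and> spectral_op f A = P ** Diag (f l) ** adj P"
proof -
  have "\<exists>Y P l. unitary P \<and> A = P ** Diag l ** adj P \<and> Y = P ** Diag (f l) ** adj P"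
    using hermitian_spectral_decomposition[OF assms] by blast
  from someI_ex[OF this] show ?thesis unfolding spectral_op_def by blast
qed

lemma Diag_mult_nth: "(Diag l *v x) $ i = complex_of_real (l $ i) * x $ i"
proof -
  have "(Diag l *v x) $ i = (\<Sum>j\<in>UNIV. if i = j then complex_of_real (l $ i) * x $ j else 0)"
    unfolding matrix_vector_mult_def Diag_def vec_lambda_beta by (intro sum.cong) auto
  then show ?thesis by simp
qed

lemma unitary_cancel: "unitary P \<Longrightarrow> adj P *v (P *v x) = x"
  by (simp add: unitary_def matrix_vector_mul_assoc)

text \<open>The eigenvalue \<open>l $ j\<close> is the value of the quadratic form at column
  \<open>j\<close> of \<open>P\<close>.\<close>

lemma psd_eigenvalues_nonneg:
  assumes "psd (P ** Diag l ** adj P)" "unitary P"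
  shows "l $ j \<ge> 0"
proof -
  let ?e = "axis j (1::complex)"
  have De: "Diag l *v ?e = l $ j *\<^sub>R ?e"
    by (simp add: vec_eq_iff Diag_mult_nth axis_def) (simp add: scaleR_conv_of_real)
  have "0 \<le> (P *v ?e) \<bullet> ((P ** Diag l ** adj P) *v (P *v ?e))"
    using assms(1) psd_iff by blast
  also have "(P ** Diag l ** adj P) *v (P *v ?e) = P *v (Diag l *v ?e)"
    using unitary_cancel[OF assms(2)] by (simp add: matrix_vector_mul_assoc[symmetric])
  also have "(P *v ?e) \<bullet> (P *v (Diag l *v ?e)) = ?e \<bullet> (Diag l *v ?e)"
    using csp_adj[of P "P *v ?e" "Diag l *v ?e"] unitary_cancel[OF assms(2)] by (simp add: Re_csp[symmetric])
  also have "\<dots> = l $ j" by (simp add: De inner_axis_axis)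
  finally show ?thesis .
qed

lemma Re_unitary_Diag_diagonal:
  "Re ((P ** Diag l ** adj P) $ i $ i) = (\<Sum>j\<in>UNIV. l $ j * (cmod (P $ i $ j))\<^sup>2)"
proof -
  have "Re (z * complex_of_real r * cnj z) = r * (cmod z)\<^sup>2" for z r
    by (simp only: cmod_power2) (simp add: power2_eq_square algebra_simps)
  then show ?thesis by (simp add: unitary_Diag_nth)
qed

text \<open>Both matrices share the eigenvectors in \<open>P\<close>, and \<open>f l\<close> is
  nonnegative with the same zero pattern as \<open>l\<close>. Hence the kernel carries over. A
  diagonal entry is a combination of eigenvalues with weights
  \<open>(cmod (P $ i $ j))\<^sup>2\<close>, so a positive one stays positive.\<close>

lemma spectral_op_kernel_diagonal:
  fixes A :: "'n::finite cmat"
  assumes psd: "psd A"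
    and f_nonneg: "\<And>x i. (\<forall>j. x $ j \<ge> 0) \<Longrightarrow> f x $ i \<ge> 0"
    and f_zero: "\<And>x i. (\<forall>j. x $ j \<ge> 0) \<Longrightarrow> (f x $ i = 0 \<longleftrightarrow> x $ i = 0)"
  shows "A *v v = 0 \<Longrightarrow> spectral_op f A *v v = 0"
    and "Re (spectral_op f A $ i $ i) \<ge> 0"
    and "Re (A $ i $ i) > 0 \<Longrightarrow> Re (spectral_op f A $ i $ i) > 0"
proof -
  obtain P l where P: "unitary P" and A: "A = P ** Diag l ** adj P"
    and F: "spectral_op f A = P ** Diag (f l) ** adj P"
    using spectral_op_decomposition psd psd_iff by blast
  have l: "\<forall>j. l $ j \<ge> 0" using psd_eigenvalues_nonneg psd A P by metis
  show "spectral_op f A *v v = 0" if "A *v v = 0"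
  proof -
    have "P *v (Diag l *v (adj P *v v)) = 0"
      using that unfolding A by (simp add: matrix_vector_mul_assoc matrix_mul_assoc)
    then have "Diag l *v (adj P *v v) = 0"
      using unitary_cancel[OF P, of "Diag l *v (adj P *v v)"] by simp
    then have "\<forall>j. l $ j = 0 \<or> (adj P *v v) $ j = 0"
      by (simp add: vec_eq_iff Diag_mult_nth)
    then have "Diag (f l) *v (adj P *v v) = 0"
      using f_zero[OF l] by (auto simp add: vec_eq_iff Diag_mult_nth)
    then show ?thesis
      unfolding F matrix_vector_mul_assoc[symmetric] by simp
  qed
  have F_ii: "Re (spectral_op f A $ i $ i) = (\<Sum>j\<in>UNIV. f l $ j * (cmod (P $ i $ j))\<^sup>2)"
    by (simp add: F Re_unitary_Diag_diagonal)
  show "Re (spectral_op f A $ i $ i) \<ge> 0"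
    unfolding F_ii using f_nonneg[OF l] by (intro sum_nonneg) simp
  show "Re (spectral_op f A $ i $ i) > 0" if "Re (A $ i $ i) > 0"
  proof -
    have "(\<Sum>j\<in>UNIV. l $ j * (cmod (P $ i $ j))\<^sup>2) \<noteq> 0"
      using that by (simp add: A Re_unitary_Diag_diagonal)
    then obtain j where "l $ j * (cmod (P $ i $ j))\<^sup>2 \<noteq> 0"
      by (meson sum.not_neutral_contains_not_neutral)
    then have "f l $ j * (cmod (P $ i $ j))\<^sup>2 > 0"
      using f_zero[OF l] f_nonneg[OF l] by (simp add: order_less_le)
    then show ?thesis
      unfolding F_ii using f_nonneg[OF l] by (intro sum_pos2[of UNIV j]) auto
  qed
qed

section \<open>Rank-one Hermitian matrices and their subtraction from a positive semidefinite
  matrix\<close>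

definition outer :: "complex^'n::finite \<Rightarrow> 'n cmat" where
  "outer v = (\<chi> i j. v $ i * cnj (v $ j))"

lemma inner_outer: "Y \<bullet> outer v = v \<bullet> (Y *v v)"
proof -
  have "Y \<bullet> outer v = (\<Sum>i\<in>UNIV. \<Sum>j\<in>UNIV. Re (cnj (Y $ i $ j) * (v $ i * cnj (v $ j))))"
    by (simp add: inner_vec_def inner_complex_def outer_def)
  also have "\<dots> = (\<Sum>i\<in>UNIV. \<Sum>j\<in>UNIV. Re (cnj (v $ i) * (Y $ i $ j * v $ j)))"
    by (intro sum.cong refl) (simp add: algebra_simps)
  also have "\<dots> = Re (csp v (Y *v v))"
    by (simp add: csp_def matrix_vector_mult_def sum_distrib_left)
  finally show ?thesis by (simp add: Re_csp)
qed

lemma outer_mult: "outer v *v x = csp v x *s v"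
  by (simp add: vec_eq_iff outer_def matrix_vector_mult_def csp_def sum_distrib_right sum_distrib_left algebra_simps)

lemma norm_outer: "norm (outer v) = (norm v)\<^sup>2"
proof -
  have "(norm (outer v))\<^sup>2 = v \<bullet> (csp v v *s v)"
    by (simp add: power2_norm_eq_inner[of "outer v"] inner_outer outer_mult)
  also have "\<dots> = ((norm v)\<^sup>2)\<^sup>2"
    by (simp add: csp_self Re_csp[symmetric] csp_simps power2_eq_square)
  finally show ?thesis using power2_eq_iff_nonneg[OF norm_ge_zero zero_le_power2] by blast
qed

lemma hermitian_outer: "hermitian (outer v)"
  by (rule hermitianI) (simp add: outer_def mult.commute)

text \<open>The form is the squared modulus of \<open>csp v x\<close>. Writing real and imaginary
  part as real inner products with \<open>v\<close> and \<open>\<i> *s v\<close> allows each to be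
  bounded by the same real inequality.\<close>

lemma quadratic_outer: "x \<bullet> (outer v *v x) = (v \<bullet> x)\<^sup>2 + ((\<i> *s v) \<bullet> x)\<^sup>2"
proof -
  have "x \<bullet> (outer v *v x) = Re (csp v x * cnj (csp v x))"
    by (simp add: outer_mult Re_csp[symmetric] csp_simps csp_commute[of x v])
  also have "\<dots> = (Re (csp v x))\<^sup>2 + (Im (csp v x))\<^sup>2" by (simp add: power2_eq_square)
  also have "Im (csp v x) = Re (csp (\<i> *s v) x)" by (simp add: csp_simps)
  finally show ?thesis by (simp only: Re_csp)
qed

text \<open>Complete the square: \<open>0 \<le> q (x - t c u)\<close> for the quadratic form \<open>q\<close> of \<open>X\<close> and
  \<open>c = \<langle>Xu, x\<rangle>\<close>.\<close>

lemma psd_range_bound: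
  assumes X: "psd X" and t: "t \<ge> 0" "t * (u \<bullet> (X *v u)) \<le> 1"
  shows "t * ((X *v u) \<bullet> x)\<^sup>2 \<le> x \<bullet> (X *v x)"
proof -
  let ?q = "\<lambda>x. x \<bullet> (X *v x)"
  define c where "c = (X *v u) \<bullet> x"
  have herm: "hermitian X" using X psd_iff by blast
  have "u \<bullet> (X *v x) = c" "x \<bullet> (X *v u) = c"
    using hermitian_inner[OF herm, of u x] by (simp_all add: c_def inner_commute)
  then have "?q (x + (- t * c) *\<^sub>R u) = ?q x - 2 * (t * c\<^sup>2) + t * c\<^sup>2 * (t * ?q u)"
    by (simp only: matrix_vector_right_distrib matrix_vector_scaleR inner_add_left inner_add_right
        inner_scaleR_left inner_scaleR_right power2_eq_square) (simp add: algebra_simps)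
  moreover have "0 \<le> ?q (x + (- t * c) *\<^sub>R u)" using X psd_iff by blast
  moreover have "t * c\<^sup>2 * (t * ?q u) \<le> t * c\<^sup>2 * 1"
    using t by (intro mult_left_mono) auto
  ultimately show ?thesis unfolding c_def[symmetric] by linarith
qed

text \<open>A rank-one term can be subtracted because its vector lies in the range of
  \<open>X\<close>. Each of the two squares that make up its quadratic form is charged to half of
  the form of \<open>X\<close>.\<close>

lemma psd_minus_outer:
  assumes X: "psd X"
  shows "\<exists>t0>0. \<forall>t. 0 \<le> t \<and> t \<le> t0 \<longrightarrow> psd (X - t *\<^sub>R outer (X *v u))"
proof -
  let ?q = "\<lambda>x. x \<bullet> (X *v x)"
  have herm: "hermitian X" using X psd_iff by blast
  have iu: "?q (\<i> *s u) = ?q u"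
    by (simp add: Re_csp[symmetric] csp_simps vec.scale)
  \<comment> \<open>Chosen so that \<open>2 * t * ?q u \<le> 1\<close> for all
    \<open>t \<le> t0\<close>; the summand 1 keeps the denominator positive when
    \<open>?q u = 0\<close>.\<close>
  define t0 where "t0 = 1 / (2 * (?q u + 1))"
  have qu: "?q u \<ge> 0" using X psd_iff by blast
  show ?thesis
  proof (intro exI[of _ t0] conjI allI impI)
    show "t0 > 0" using qu by (simp add: t0_def)
    fix t assume t: "0 \<le> t \<and> t \<le> t0"
    have tq: "2 * t * ?q u \<le> 1"
    proof -
      have "2 * t * ?q u \<le> 2 * t0 * (?q u + 1)"
        using t qu by (intro mult_mono) auto
      then show ?thesis using qu by (simp add: t0_def)
    qed
    show "psd (X - t *\<^sub>R outer (X *v u))"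
      unfolding psd_iff
    proof (intro conjI allI)
      show "hermitian (X - t *\<^sub>R outer (X *v u))"
        using hermitian_comb[OF herm hermitian_outer, of 1 "-t"] by simp
      fix x
      have "2 * t * ((X *v u) \<bullet> x)\<^sup>2 \<le> ?q x"
        using psd_range_bound[OF X, of "2 * t" u x] t tq by simp
      \<comment> \<open>The imaginary part is the same bound at \<open>\<i> *s u\<close>, which has
        the same value of the form and is mapped by \<open>X\<close> to
        \<open>\<i> *s (X *v u)\<close>.\<close>
      moreover have "2 * t * ((\<i> *s (X *v u)) \<bullet> x)\<^sup>2 \<le> ?q x"
        using psd_range_bound[OF X, of "2 * t" "\<i> *s u" x] t tq iu by (simp add: vec.scale)
      moreover have "x \<bullet> ((X - t *\<^sub>R outer (X *v u)) *v x) = ?q x - t * (x \<bullet> (outer (X *v u) *v x))"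
        using matrix_vector_comb[of 1 X "-t" "outer (X *v u)" x] by (simp add: inner_diff_right)
      ultimately show "0 \<le> x \<bullet> ((X - t *\<^sub>R outer (X *v u)) *v x)"
        by (simp add: quadratic_outer algebra_simps)
    qed
  qed
qed

section \<open>Comparison of ranks through ranges of transposes\<close>

lemma span_columns_range: "vec.span (columns A) = range ((*v) (A::'n::finite cmat))"
proof
  have "column i A = A *v axis i 1" for i
    by (simp add: vec_eq_iff column_def matrix_vector_mult_def axis_def if_distrib[of "\<lambda>x. _ * x"] cong: if_cong)
  then have "columns A \<subseteq> range ((*v) A)"
    by (auto simp: columns_def)
  then show "vec.span (columns A) \<subseteq> range ((*v) A)"
    by (intro vec.span_minimal matrix_vector_mul_linear_gen vec.subspace_UNIV vec.linear_subspace_image)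
  show "range ((*v) A) \<subseteq> vec.span (columns A)"
    using matrix_vector_mult_in_columnspace_gen by blast
qed

text \<open>\<open>rank\<close> is a row rank, and the rows of \<open>A\<close> are the columns of
  its transpose; this is why transposes appear in the comparisons below.\<close>

lemma rank_eq_dim_range_transpose: "rank (A::'n::finite cmat) = vec.dim (range ((*v) (transpose A)))"
  by (metis columns_transpose row_rank_def_gen span_columns_range vec.dim_span)

text \<open>The assumption says that \<open>transpose B\<close> is injective on the range of
  \<open>transpose A\<close>, so it carries that range to a space of equal dimension inside its own
  range. Its contrapositive turns a rank gap into a kernel vector.\<close>

lemma rank_le_if_inj_on:
  fixes A B :: "'n::finite cmat"
  assumes inj: "\<And>y. transpose B *v (transpose A *v y) = 0 \<Longrightarrow> transpose A *v y = 0"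
  shows "rank A \<le> rank B"
proof -
  let ?R = "range ((*v) (transpose A))"
  have sub: "vec.subspace ?R" by (metis span_columns_range vec.subspace_span)
  have "inj_on ((*v) (transpose B)) ?R"
  proof (rule inj_onI)
    fix x y assume "transpose B *v x = transpose B *v y" "x \<in> ?R" "y \<in> ?R" 
    then have "x - y \<in> ?R" using sub vec.subspace_diff by blast
    then obtain z where "x - y = transpose A *v z" by blast
    moreover have "transpose B *v (x - y) = 0"
      using \<open>transpose B *v x = transpose B *v y\<close> by (simp only: matrix_vector_mult_diff_distrib) simp
    ultimately have "x - y = 0" using inj by metis
    then show "x = y" by simp
  qed
  then have "vec.dim ((*v) (transpose B) ` ?R) = vec.dim ?R"
    using sub by (intro vec.dim_image_eq matrix_vector_mul_linear_gen) (simp add: vec.span_eq_iff[THEN iffD2])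
  moreover have "vec.dim ((*v) (transpose B) ` ?R) \<le> vec.dim (range ((*v) (transpose B)))"
    by (intro vec.dim_subset) auto
  ultimately show ?thesis by (simp add: rank_eq_dim_range_transpose)
qed

section \<open>Kernel vectors and semicontinuity of the rank\<close>

definition vcnj :: "complex^'n \<Rightarrow> complex^'n" where "vcnj x = (\<chi> i. cnj (x $ i))"

text \<open>The transpose of a Hermitian matrix is its entrywise conjugate, so conjugating vectors
  turns statements about transposes into statements about the matrix itself.\<close>

lemma transpose_mult_vcnj: "hermitian A \<Longrightarrow> A *v vcnj x = vcnj (transpose A *v x)"
proof -
  assume A: "hermitian A"
  have "(A *v vcnj x) $ i = vcnj (transpose A *v x) $ i" for i
    using hermitian_nth[OF A, of i]
    by (simp add: vcnj_def matrix_vector_mult_def transpose_def del: transpose_matrix_vector)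
  then show ?thesis by (simp add: vec_eq_iff)
qed

lemma vcnj_eq_0: "vcnj x = 0 \<longleftrightarrow> x = 0"
  by (simp add: vcnj_def vec_eq_iff)

lemma real_mat_Re_Im:
  assumes A: "real_mat A"
  shows "A *v (\<chi> i. complex_of_real (Re (x $ i))) = (\<chi> i. complex_of_real (Re ((A *v x) $ i)))"
    and "A *v (\<chi> i. complex_of_real (Im (x $ i))) = (\<chi> i. complex_of_real (Im ((A *v x) $ i)))"
  using A by (simp_all add: vec_eq_iff matrix_vector_mult_def real_mat_def complex_eq_iff)

text \<open>A rank gap yields a nonzero vector in the range of \<open>B\<close> killed by
  \<open>A\<close>. In the real case it must be real as well, so that its rank-one matrix stays in
  \<open>Sn rc\<close>.\<close>

lemma rank_less_kernel_vector:
  fixes A B :: "'n::finite cmat"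
  assumes A: "A \<in> Sn rc" and B: "B \<in> Sn rc" and less: "rank A < rank B"
  shows "\<exists>u. B *v u \<noteq> 0 \<and> A *v (B *v u) = 0 \<and> (rc \<longrightarrow> (\<forall>i. Im ((B *v u) $ i) = 0))"
proof -
  have herm: "hermitian A" "hermitian B" using A B by (auto simp: Sn_def)
  obtain y where y: "transpose A *v (transpose B *v y) = 0" "transpose B *v y \<noteq> 0"
    using rank_le_if_inj_on[of A B] less by force
  define u where "u = vcnj y"
  have Bu: "B *v u \<noteq> 0" and ABu: "A *v (B *v u) = 0"
    using y by (simp_all add: u_def transpose_mult_vcnj herm vcnj_eq_0 del: transpose_matrix_vector)
  show ?thesis
  proof (cases rc)
    case False then show ?thesis using Bu ABu by blast
  next
    case True
    then have r: "real_mat A" "real_mat B" using A B by (auto simp: Sn_def)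
    note R = real_mat_Re_Im[OF r(1)] real_mat_Re_Im[OF r(2)]
    show ?thesis
    \<comment> \<open>Real matrices commute with taking real and imaginary parts of vectors, so both
      parts of \<open>B *v u\<close> qualify except that one may vanish; they cannot both
      vanish.\<close>
    proof (cases "(\<chi> i. complex_of_real (Re ((B *v u) $ i))) = 0")
      case False
      then show ?thesis
        using ABu by (intro exI[of _ "\<chi> i. complex_of_real (Re (u $ i))"]) (simp only: R, simp add: vec_eq_iff)
    next
      case True
      then have "(\<chi> i. complex_of_real (Im ((B *v u) $ i))) \<noteq> 0"
        using Bu by (auto simp add: vec_eq_iff complex_eq_iff)
      then show ?thesis
        using ABu by (intro exI[of _ "\<chi> i. complex_of_real (Im (u $ i))"]) (simp only: R, simp add: vec_eq_iff)
    qed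
  qed
qed

text \<open>Crude but sufficient: Cauchy-Schwarz bounds each coordinate, and there are
  \<open>CARD('n)\<close> of them.\<close>

lemma norm_matrix_vector_le: "norm ((A::'n::finite cmat) *v x) \<le> real CARD('n) * (norm A * norm x)"
proof -
  have "norm ((A *v x) $ i) \<le> norm A * norm x" for i
  proof -
    have Ax: "(A *v x) $ i = csp (vcnj (A $ i)) x"
      by (simp add: csp_def vcnj_def matrix_vector_mult_def)
    have "cmod (csp a x) \<le> norm a * norm x" for a
    proof -
      have "cmod (csp a x) \<le> (\<Sum>i\<in>UNIV. \<bar>norm (a $ i)\<bar> * \<bar>norm (x $ i)\<bar>)"
        unfolding csp_def by (intro order_trans[OF norm_sum] sum_mono) (simp add: norm_mult)
      also have "\<dots> \<le> norm a * norm x" unfolding norm_vec_def by (rule L2_set_mult_ineq)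
      finally show ?thesis .
    qed
    then have "norm ((A *v x) $ i) \<le> norm (vcnj (A $ i)) * norm x" unfolding Ax .
    also have "norm (vcnj (A $ i)) = norm (A $ i)" by (simp add: vcnj_def norm_vec_def)
    also have "norm (A $ i) * norm x \<le> norm A * norm x" by (intro mult_right_mono Finite_Cartesian_Product.norm_nth_le) simp
    finally show ?thesis .
  qed
  then have "(\<Sum>i\<in>UNIV. norm ((A *v x) $ i)) \<le> (\<Sum>i\<in>(UNIV::'n set). norm A * norm x)"
    by (intro sum_mono)
  moreover have "norm (A *v x) \<le> (\<Sum>i\<in>UNIV. norm ((A *v x) $ i))"
    unfolding norm_vec_def by (intro L2_set_le_sum) auto
  ultimately show ?thesis by simp
qed

text \<open>The Hermitian matrix \<open>transpose A\<close> is injective on its own range, hence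
  bounded below there by some \<open>e > 0\<close>. A perturbation smaller than
  \<open>e / CARD('n)\<close> cannot destroy this injectivity.\<close>

lemma rank_lower_semicontinuous:
  fixes A :: "'n::finite cmat"
  assumes A: "hermitian A"
  shows "\<exists>c>0. \<forall>B. norm (B - A) < c \<longrightarrow> rank A \<le> rank B"
proof -
  let ?T = "transpose A"
  let ?R = "range ((*v) ?T)"
  have hT: "hermitian ?T"
    by (rule hermitianI, unfold transpose_def vec_lambda_beta) (rule hermitian_nth[OF A])
  have lin: "linear ((*v) C)" for C :: "'n cmat"
    by (intro linearI) (simp_all add: matrix_vector_right_distrib matrix_vector_scaleR del: transpose_matrix_vector)
  have sub: "subspace ?R" using linear_subspace_image[OF lin subspace_UNIV] .
  \<comment> \<open>Range and kernel of a Hermitian matrix are orthogonal, so they meet only in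
    0.\<close>
  have "x = 0" if "x \<in> ?R" "?T *v x = 0" for x
  proof -
    from that obtain y where "x = ?T *v y" by blast
    then have "x \<bullet> x = y \<bullet> (?T *v x)" using hermitian_inner[OF hT, of y x] by metis
    then show ?thesis using that by simp
  qed
  then obtain e where e: "e > 0" "\<And>x. x \<in> ?R \<Longrightarrow> norm (?T *v x) \<ge> e * norm x"
    using injective_imp_isometric[OF closed_subspace[OF sub] sub linear_conv_bounded_linear[THEN iffD1, OF lin[of ?T]]]
    by blast
  show ?thesis
  proof (intro exI[of _ "e / CARD('n)"] conjI allI impI)
    fix B :: "'n cmat" assume B: "norm (B - A) < e / CARD('n)"
    show "rank A \<le> rank B"
    proof (rule rank_le_if_inj_on)
      fix y let ?x = "?T *v y"
      assume "transpose B *v ?x = 0"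
      then have "?T *v ?x = - ((transpose B - ?T) *v ?x)"
        by (simp add: matrix_vector_mult_diff_rdistrib del: transpose_matrix_vector)
      then have "e * norm ?x \<le> norm ((transpose B - ?T) *v ?x)"
        using e(2)[of ?x] by (metis norm_minus_cancel rangeI)
      also have "\<dots> \<le> real CARD('n) * (norm (transpose B - ?T) * norm ?x)"
        by (rule norm_matrix_vector_le)
      also have "norm (transpose B - ?T) = norm (B - A)"
      proof -
        have "ip (transpose B - ?T) (transpose B - ?T) = ip (B - A) (B - A)"
          by (simp add: ip_eq_inner inner_vec_def transpose_def) (rule sum.swap)
        then show ?thesis by (metis frob_def frob_eq_norm)
      qed
      finally have "(e - real CARD('n) * norm (B - A)) * norm ?x \<le> 0" by (simp add: algebra_simps)
      moreover have "e - real CARD('n) * norm (B - A) > 0" using B by (simp add: field_simps)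
      ultimately have "norm ?x \<le> 0" by (simp add: mult_le_0_iff)
      then show "?x = 0" by simp
    qed
  qed (use e in simp)
qed

section \<open>Correction matrices that restore the fixed coefficients\<close>

lemma outer_Sn: "(rc \<longrightarrow> (\<forall>i. Im (v $ i) = 0)) \<Longrightarrow> outer v \<in> Sn rc"
  by (auto simp: Sn_def hermitian_outer real_mat_def) (simp add: outer_def)

lemma inner_mat_1: "mat 1 \<bullet> (Y::'n::finite cmat) = (\<Sum>i\<in>UNIV. Re (Y $ i $ i))"
proof -
  have "(if i = j then 1 else 0) \<bullet> Y $ i $ j = (if i = j then Re (Y $ i $ j) else 0)" for i j
    by (simp add: inner_complex_def)
  then show ?thesis by (simp add: inner_vec_def mat_def)
qed

lemma norm_vec_sq: "(norm (v::complex^'n))\<^sup>2 = (\<Sum>i\<in>UNIV. (cmod (v $ i))\<^sup>2)"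
  by (simp add: norm_vec_def L2_set_def sum_nonneg)

text \<open>The witness is the diagonal matrix with entries \<open>(cmod (v $ i))\<^sup>2\<close> on
  \<open>I\<close>. The penalty gains \<open>(norm v)\<^sup>2\<close> from removing
  \<open>outer v\<close>, because \<open>F\<close> kills \<open>v\<close>, and loses at most
  \<open>(1 - \<delta>) * (norm v)\<^sup>2\<close> from adding \<open>C\<close>.\<close>

lemma correction_diagonal:
  fixes Xbar F :: "'n::finite cmat" and I :: "'n set"
  assumes F_pos: "\<And>i. i \<in> I \<Longrightarrow> Re (F $ i $ i) > 0"
    and F_ker: "\<And>v. Xbar *v v = 0 \<Longrightarrow> F *v v = 0"
  shows "\<exists>\<delta>>0. \<forall>v. Xbar *v v = 0 \<longrightarrow> (\<exists>C. psd C \<and> C \<in> Sn rc \<and>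
           (\<forall>i\<in>I. unitmat i i \<bullet> (C - outer v) = 0) \<and>
           (\<forall>Y. (\<forall>i\<in>I. unitmat i i \<bullet> Y = 0) \<longrightarrow> Y \<bullet> C = 0) \<and>
           norm (C - outer v) \<le> 2 * (norm v)\<^sup>2 \<and>
           (mat 1 - F) \<bullet> (C - outer v) \<le> - \<delta> * (norm v)\<^sup>2)"
proof -
  \<comment> \<open>The inserted 1 covers an empty \<open>I\<close> and gives
    \<open>1 - \<delta> \<ge> 0\<close>, which is needed at coordinates outside
    \<open>I\<close>.\<close>
  define \<delta> where "\<delta> = Min (insert 1 ((\<lambda>i. Re (F $ i $ i)) ` I))"
  have \<delta>: "\<delta> > 0" "\<delta> \<le> 1" "\<And>i. i \<in> I \<Longrightarrow> \<delta> \<le> Re (F $ i $ i)"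
    using F_pos by (auto simp: \<delta>_def)
  have unitmat_inner: "unitmat i i \<bullet> Y = Re (Y $ i $ i)" for i and Y :: "'n cmat"
  proof -
    have "(unitmat i i :: 'n cmat) $ a $ b \<bullet> Y $ a $ b
        = (if a = i then if b = i then Re (Y $ a $ b) else 0 else 0)" for a b
      by (simp add: unitmat_def inner_complex_def)
    then have "unitmat i i \<bullet> Y = (\<Sum>a\<in>UNIV. \<Sum>b\<in>UNIV. (if a = i then if b = i then Re (Y $ a $ b) else 0 else 0))"
      by (simp add: inner_vec_def)
    also have "\<dots> = (\<Sum>a\<in>UNIV. if a = i then \<Sum>b\<in>UNIV. if b = i then Re (Y $ a $ b) else 0 else 0)"
      by (intro sum.cong) auto
    finally show ?thesis by simp
  qed
  show ?thesis
  proof (intro exI[of _ \<delta>] conjI allI impI \<delta>(1))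
    fix v :: "complex^'n" assume v: "Xbar *v v = 0"
    define w :: "real^'n" where "w = (\<chi> i. if i \<in> I then (cmod (v $ i))\<^sup>2 else 0)"
    define C :: "'n cmat" where "C = Diag w"
    have w: "w $ i \<ge> 0" for i by (simp add: w_def)
    have hC: "hermitian C" by (rule hermitianI) (simp add: C_def Diag_def)
    have CY: "Y \<bullet> C = (\<Sum>i\<in>UNIV. w $ i * Re (Y $ i $ i))" for Y
    proof -
      have "Y $ i $ j \<bullet> C $ i $ j = (if i = j then w $ i * Re (Y $ i $ j) else 0)" for i j
        by (simp add: C_def Diag_def inner_complex_def)
      then show ?thesis by (simp add: inner_vec_def)
    qed
    have Cii: "Re (C $ i $ i) = w $ i" for i by (simp add: C_def Diag_def)
    have oii: "Re (outer v $ i $ i) = (cmod (v $ i))\<^sup>2" for i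
      by (simp only: cmod_power2) (simp add: outer_def power2_eq_square)
    have w_le: "(\<Sum>i\<in>UNIV. w $ i) \<le> (norm v)\<^sup>2"
      unfolding norm_vec_sq by (intro sum_mono) (simp add: w_def)
    have "(norm C)\<^sup>2 \<le> ((norm v)\<^sup>2)\<^sup>2"
    proof -
      have "(norm C)\<^sup>2 = (\<Sum>i\<in>UNIV. w $ i * w $ i)"
        unfolding power2_norm_eq_inner CY Cii ..
      also have "\<dots> \<le> (\<Sum>i\<in>UNIV. w $ i * (norm v)\<^sup>2)"
        using w_le w member_le_sum[of _ UNIV "\<lambda>i. w $ i"]
        by (intro sum_mono mult_left_mono w) (metis UNIV_I finite order_trans)
      also have "\<dots> = (\<Sum>i\<in>UNIV. w $ i) * (norm v)\<^sup>2" by (simp add: sum_distrib_right)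
      also have "\<dots> \<le> (norm v)\<^sup>2 * (norm v)\<^sup>2" using w_le by (intro mult_right_mono) auto
      finally show ?thesis by (simp add: power2_eq_square)
    qed
    then have "norm C \<le> (norm v)\<^sup>2" by (rule power2_le_imp_le) simp
    then have nD: "norm (C - outer v) \<le> 2 * (norm v)\<^sup>2"
      using norm_triangle_ineq4[of C "outer v"] norm_outer[of v] by simp
    have "(mat 1 - F) \<bullet> (C - outer v) \<le> - \<delta> * (norm v)\<^sup>2"
    proof -
      have "(mat 1 - F) \<bullet> outer v = (norm v)\<^sup>2"
        using F_ker[OF v] by (simp add: inner_outer matrix_vector_mult_diff_rdistrib power2_norm_eq_inner)
      moreover have "(mat 1 - F) \<bullet> C = (\<Sum>i\<in>UNIV. w $ i * (1 - Re (F $ i $ i)))"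
        by (simp add: CY mat_def)
      moreover have "\<dots> \<le> (\<Sum>i\<in>UNIV. (cmod (v $ i))\<^sup>2 * (1 - \<delta>))"
      proof (intro sum_mono)
        fix i
        show "w $ i * (1 - Re (F $ i $ i)) \<le> (cmod (v $ i))\<^sup>2 * (1 - \<delta>)"
          using \<delta>(2) \<delta>(3)[of i] by (cases "i \<in> I") (auto simp: w_def intro!: mult_left_mono)
      qed
      moreover have "\<dots> = (norm v)\<^sup>2 * (1 - \<delta>)" by (simp add: norm_vec_sq sum_distrib_right)
      ultimately show ?thesis by (simp add: inner_diff_right algebra_simps)
    qed
    moreover have "psd C"
    proof -
      have "x \<bullet> (C *v x) = (\<Sum>i\<in>UNIV. w $ i * (cmod (x $ i))\<^sup>2)" for x
      proof -
        have "x $ i \<bullet> (C *v x) $ i = w $ i * (cmod (x $ i))\<^sup>2" for i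
          by (simp only: cmod_power2)
            (simp add: C_def Diag_mult_nth inner_complex_def power2_eq_square algebra_simps)
        then show ?thesis by (simp add: inner_vec_def)
      qed
      then show ?thesis using hC w by (auto simp: psd_iff intro!: sum_nonneg)
    qed
    moreover have "C \<in> Sn rc" using hC by (simp add: Sn_def real_mat_def C_def Diag_def)
    moreover have "\<forall>i\<in>I. unitmat i i \<bullet> (C - outer v) = 0"
      using Cii oii by (simp add: unitmat_inner w_def)
    moreover have "\<forall>Y. (\<forall>i\<in>I. unitmat i i \<bullet> Y = 0) \<longrightarrow> Y \<bullet> C = 0"
      unfolding CY unitmat_inner by (auto simp: w_def intro!: sum.neutral)
    ultimately show "\<exists>C. psd C \<and> C \<in> Sn rc \<and>
           (\<forall>i\<in>I. unitmat i i \<bullet> (C - outer v) = 0) \<and>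
           (\<forall>Y. (\<forall>i\<in>I. unitmat i i \<bullet> Y = 0) \<longrightarrow> Y \<bullet> C = 0) \<and>
           norm (C - outer v) \<le> 2 * (norm v)\<^sup>2 \<and>
           (mat 1 - F) \<bullet> (C - outer v) \<le> - \<delta> * (norm v)\<^sup>2"
      using nD by blast
  qed
qed

text \<open>Here the witness is the multiple of the identity with the trace of
  \<open>outer v\<close>. The gain rate \<open>\<delta>\<close> is the normalised trace of
  \<open>F\<close>.\<close>

lemma correction_trace:
  fixes Xbar F :: "'n::finite cmat"
  assumes F_trace: "mat 1 \<bullet> F > 0"
    and F_ker: "\<And>v. Xbar *v v = 0 \<Longrightarrow> F *v v = 0"
  shows "\<exists>\<delta>>0. \<forall>v. Xbar *v v = 0 \<longrightarrow> (\<exists>C. psd C \<and> C \<in> Sn rc \<and>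
           mat 1 \<bullet> (C - outer v) = 0 \<and>
           (\<forall>Y. mat 1 \<bullet> Y = 0 \<longrightarrow> Y \<bullet> C = 0) \<and>
           norm (C - outer v) \<le> 2 * (norm v)\<^sup>2 \<and>
           (mat 1 - F) \<bullet> (C - outer v) \<le> - \<delta> * (norm v)\<^sup>2)"
proof -
  define n where "n = real CARD('n)"
  have n: "n \<ge> 1" by (simp add: n_def Suc_leI)
  define \<delta> where "\<delta> = mat 1 \<bullet> F / n"
  have nn: "(mat 1::'n cmat) \<bullet> mat 1 = n" unfolding inner_mat_1 by (simp add: mat_def n_def)
  show ?thesis
  proof (intro exI[of _ \<delta>] conjI allI impI)
    show "\<delta> > 0" using F_trace n by (simp add: \<delta>_def)
    fix v :: "complex^'n" assume v: "Xbar *v v = 0"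
    define C :: "'n cmat" where "C = ((norm v)\<^sup>2 / n) *\<^sub>R mat 1"
    have Cx: "C *v x = ((norm v)\<^sup>2 / n) *\<^sub>R x" for x
      using matrix_vector_comb[of "(norm v)\<^sup>2 / n" "mat 1" 0 0 x] by (simp add: C_def)
    have herm1: "hermitian (mat 1 :: 'n cmat)" by (rule hermitianI) (simp add: mat_def)
    have hC: "hermitian C" using hermitian_comb[OF herm1 herm1, of "(norm v)\<^sup>2 / n" 0] by (simp add: C_def)
    have "psd C" using hC n by (simp add: psd_iff Cx)
    moreover have "C \<in> Sn rc"
      using hC by (auto simp: Sn_def real_mat_def C_def scaleR_cmat_nth mat_def simp del: vector_scaleR_component)
    moreover have mo: "mat 1 \<bullet> outer v = (norm v)\<^sup>2" by (simp add: inner_outer power2_norm_eq_inner)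
    then have "mat 1 \<bullet> (C - outer v) = 0"
      using n by (simp add: inner_diff_right C_def nn)
    moreover have "\<forall>Y. mat 1 \<bullet> Y = 0 \<longrightarrow> Y \<bullet> C = 0"
      by (simp add: C_def inner_commute)
    moreover have "norm (C - outer v) \<le> 2 * (norm v)\<^sup>2"
    proof -
      have "norm (mat 1 :: 'n cmat) \<le> n"
      proof -
        have "(norm (mat 1 :: 'n cmat))\<^sup>2 = n" by (simp only: power2_norm_eq_inner nn)
        also have "n \<le> n\<^sup>2" using n by (simp add: self_le_power)
        finally have "(norm (mat 1 :: 'n cmat))\<^sup>2 \<le> n\<^sup>2" .
        then show ?thesis by (rule power2_le_imp_le) (use n in simp)
      qed
      then have "\<bar>(norm v)\<^sup>2 / n\<bar> * norm (mat 1 :: 'n cmat) \<le> \<bar>(norm v)\<^sup>2 / n\<bar> * n"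
        by (intro mult_left_mono) auto
      moreover have "\<bar>(norm v)\<^sup>2 / n\<bar> * n = (norm v)\<^sup>2" using n by simp
      ultimately have "norm C \<le> (norm v)\<^sup>2" by (simp only: C_def norm_scaleR)
      then show ?thesis
        using n norm_triangle_ineq4[of C "outer v"] norm_outer[of v] by simp
    qed
    moreover have "(mat 1 - F) \<bullet> (C - outer v) \<le> - \<delta> * (norm v)\<^sup>2"
    proof -
      have "(mat 1 - F) \<bullet> outer v = (norm v)\<^sup>2"
        using F_ker[OF v] by (simp add: inner_outer matrix_vector_mult_diff_rdistrib power2_norm_eq_inner)
      moreover have "(mat 1 - F) \<bullet> C = (norm v)\<^sup>2 / n * (n - mat 1 \<bullet> F)"
        by (simp only: C_def inner_scaleR_right inner_diff_left nn inner_commute[of F])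
      moreover have "\<dots> = (norm v)\<^sup>2 - \<delta> * (norm v)\<^sup>2"
        using n by (simp add: \<delta>_def right_diff_distrib)
      ultimately show ?thesis by (simp add: inner_diff_right)
    qed
    ultimately show "\<exists>C. psd C \<and> C \<in> Sn rc \<and>
           mat 1 \<bullet> (C - outer v) = 0 \<and>
           (\<forall>Y. mat 1 \<bullet> Y = 0 \<longrightarrow> Y \<bullet> C = 0) \<and>
           norm (C - outer v) \<le> 2 * (norm v)\<^sup>2 \<and>
           (mat 1 - F) \<bullet> (C - outer v) \<le> - \<delta> * (norm v)\<^sup>2" by blast
  qed
qed

section \<open>First-order optimality\<close>

text \<open>Along \<open>X + t *\<^sub>R D\<close> the objective is a quadratic polynomial in
  \<open>t\<close> with linear coefficient \<open>?L\<close>. Divide its nonnegative increment by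
  \<open>t\<close> and let \<open>t\<close> tend to 0 from the right, the only side on which
  feasibility is assumed.\<close>

lemma first_order_optimality:
  fixes X D :: "'n::finite cmat"
  assumes opt: "is_opt (rc_objective \<Theta> Xbar \<nu> w z m \<rho> \<gamma> Xt G) C X"
    and t0: "t0 > 0" and feas: "\<And>t. 0 < t \<Longrightarrow> t \<le> t0 \<Longrightarrow> X + t *\<^sub>R D \<in> C"
  shows "0 \<le> 1 / real m * (\<Sum>i\<in>{1..m}. (\<Theta> (w i) \<bullet> (X - Xbar) - \<nu> * z i) * (\<Theta> (w i) \<bullet> D))
            + \<rho> * ((mat 1 - G) \<bullet> D + \<gamma> * ((X - Xt) \<bullet> D))" (is "0 \<le> ?L")
proof -
  let ?obj = "rc_objective \<Theta> Xbar \<nu> w z m \<rho> \<gamma> Xt G"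
  define Q where "Q = 1 / (2 * real m) * (\<Sum>i\<in>{1..m}. (\<Theta> (w i) \<bullet> D)\<^sup>2) + \<rho> * (\<gamma> / 2 * (D \<bullet> D))"
  have expand: "?obj (X + t *\<^sub>R D) = ?obj X + t * ?L + t\<^sup>2 * Q" for t
  proof -
    define a where "a i = \<Theta> (w i) \<bullet> (X - Xbar) - \<nu> * z i" for i
    define b where "b i = \<Theta> (w i) \<bullet> D" for i
    have r1: "(\<Theta> (w i) \<bullet> Xbar + \<nu> * z i - \<Theta> (w i) \<bullet> X)\<^sup>2 = (a i)\<^sup>2" for i
      unfolding a_def by (simp add: inner_diff_right power2_eq_square algebra_simps)
    have r2: "(\<Theta> (w i) \<bullet> Xbar + \<nu> * z i - \<Theta> (w i) \<bullet> (X + t *\<^sub>R D))\<^sup>2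
       = (a i)\<^sup>2 + 2 * t * (a i * b i) + t\<^sup>2 * (b i)\<^sup>2" for i
      unfolding a_def b_def
      by (simp add: inner_diff_right inner_add_right power2_eq_square algebra_simps)
    have n: "(norm (X + t *\<^sub>R D - Xt))\<^sup>2 = (norm (X - Xt))\<^sup>2 + 2 * t * ((X - Xt) \<bullet> D) + t\<^sup>2 * (D \<bullet> D)"
    proof -
      have "X + t *\<^sub>R D - Xt = (X - Xt) + t *\<^sub>R D" by simp
      then show ?thesis
        by (simp only: power2_norm_eq_inner inner_add_left inner_add_right inner_scaleR_left inner_scaleR_right)
          (simp add: inner_commute power2_eq_square algebra_simps)
    qed
    have sums: "(\<Sum>i\<in>{1..m}. (a i)\<^sup>2 + 2 * t * (a i * b i) + t\<^sup>2 * (b i)\<^sup>2)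
       = (\<Sum>i\<in>{1..m}. (a i)\<^sup>2) + 2 * t * (\<Sum>i\<in>{1..m}. a i * b i) + t\<^sup>2 * (\<Sum>i\<in>{1..m}. (b i)\<^sup>2)"
      by (simp only: sum.distrib sum_distrib_left)
    define h SA SAB SB where "h = 1 / (2 * real m)" and "SA = (\<Sum>i\<in>{1..m}. (a i)\<^sup>2)"
      and "SAB = (\<Sum>i\<in>{1..m}. a i * b i)" and "SB = (\<Sum>i\<in>{1..m}. (b i)\<^sup>2)"
    have h: "1 / real m = 2 * h" by (simp add: h_def)
    show ?thesis
      unfolding rc_objective_def ip_eq_inner frob_eq_norm r1 r2 n Q_def a_def[symmetric] b_def[symmetric] sums
        SA_def[symmetric] SAB_def[symmetric] SB_def[symmetric] h_def[symmetric] h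
      by (simp add: inner_add_right algebra_simps)
  qed
  have "?L + t * Q \<ge> 0" if "0 < t" "t \<le> t0" for t
  proof -
    have "?obj X \<le> ?obj (X + t *\<^sub>R D)" using opt feas[OF that] by (simp add: is_opt_def)
    then have "0 \<le> t * (?L + t * Q)" unfolding expand by (simp add: algebra_simps power2_eq_square)
    then show ?thesis using that by (simp add: zero_le_mult_iff)
  qed
  moreover have "((\<lambda>t. ?L + t * Q) \<longlongrightarrow> ?L + 0 * Q) (at_right 0)"
    by (intro tendsto_intros)
  moreover have "eventually (\<lambda>t. 0 < t \<and> t \<le> t0) (at_right (0::real))"
    using t0 eventually_at_right_less[of 0] eventually_at_right_real[OF t0]
    by (auto elim!: eventually_mono)
  ultimately show ?thesis
    by (intro tendsto_lowerbound[of "\<lambda>t. ?L + t * Q" ?L "at_right 0" 0]) (auto elim!: eventually_mono)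
qed

text \<open>For constant \<open>u = 1\<close> this is the empirical frequency of the basis index
  \<open>k\<close>; for the noise it is the noise collected at \<open>k\<close>, divided by the full
  sample size rather than by the number of hits.\<close>

definition slot_avg :: "(nat \<Rightarrow> nat) \<Rightarrow> nat \<Rightarrow> (nat \<Rightarrow> real) \<Rightarrow> nat \<Rightarrow> real" where
  "slot_avg w m u k = 1 / real m * (\<Sum>i\<in>{1..m}. u i * (if w i = k then 1 else 0))"

text \<open>Grouping the samples by their index leaves a sum over the fixed finite set
  \<open>\<beta>\<close>, so only finitely many averages have to be controlled in
  probability.\<close>

lemma average_by_slots:
  assumes "finite \<beta>" "\<And>i. w i \<in> \<beta>"
  shows "1 / real m * (\<Sum>i\<in>{1..m}. u i * g (w i)) = (\<Sum>k\<in>\<beta>. slot_avg w m u k * g k)"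
proof -
  have "g (w i) = (\<Sum>k\<in>\<beta>. (if w i = k then 1 else 0) * g k)" for i
    using assms by (simp add: if_distrib[of "\<lambda>x. x * _"] cong: if_cong)
  then have "(\<Sum>i\<in>{1..m}. u i * g (w i)) = (\<Sum>i\<in>{1..m}. \<Sum>k\<in>\<beta>. u i * (if w i = k then 1 else 0) * g k)"
    by (simp add: sum_distrib_left mult.assoc)
  also have "\<dots> = (\<Sum>k\<in>\<beta>. (\<Sum>i\<in>{1..m}. u i * (if w i = k then 1 else 0)) * g k)"
    by (subst sum.swap) (simp add: sum_distrib_right)
  finally have eq: "(\<Sum>i\<in>{1..m}. u i * g (w i)) = (\<Sum>k\<in>\<beta>. (\<Sum>i\<in>{1..m}. u i * (if w i = k then 1 else 0)) * g k)" .
  show ?thesis unfolding eq slot_avg_def by (subst sum_distrib_left) (simp add: mult.assoc)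
qed

section \<open>Deterministic estimates from the first-order inequality\<close>

lemma sum_mult_bound:
  fixes a c :: "nat \<Rightarrow> real"
  assumes "\<And>k. k \<in> \<beta> \<Longrightarrow> \<bar>a k\<bar> \<le> A" "\<And>k. k \<in> \<beta> \<Longrightarrow> \<bar>c k\<bar> \<le> C" "A \<ge> 0"
  shows "\<bar>\<Sum>k\<in>\<beta>. a k * c k\<bar> \<le> real (card \<beta>) * (A * C)"
proof -
  have "\<bar>\<Sum>k\<in>\<beta>. a k * c k\<bar> \<le> (\<Sum>k\<in>\<beta>. \<bar>a k * c k\<bar>)" by (rule sum_abs)
  also have "\<dots> \<le> (\<Sum>k\<in>\<beta>. A * C)"
    unfolding abs_mult using assms by (intro sum_mono mult_mono) auto
  finally show ?thesis by simp
qed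

text \<open>In the application \<open>p\<close> and \<open>N\<close> are the slot averages of 1 and
  of the noise, \<open>E\<close> is the identity, and \<open>F\<close> and \<open>G\<close> are the
  values of the spectral operator at \<open>Xbar\<close> and at the initial estimator. One tolerance
  \<open>\<eta>\<close> serves all deviations.\<close>

context
  fixes \<Theta> :: "nat \<Rightarrow> 'e::real_inner" and \<beta> :: "nat set" and p N :: "nat \<Rightarrow> real"
    and \<nu> \<rho> \<gamma> \<eta> :: real and X Xbar Xt F G E Y :: 'e
  assumes fin: "finite \<beta>" and ne: "\<beta> \<noteq> {}" and unit: "\<And>k. k \<in> \<beta> \<Longrightarrow> norm (\<Theta> k) = 1"
    and p: "\<And>k. k \<in> \<beta> \<Longrightarrow> \<bar>p k - 1 / real (card \<beta>)\<bar> \<le> \<eta>"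
    and N: "\<And>k. k \<in> \<beta> \<Longrightarrow> \<bar>N k\<bar> \<le> \<eta> * \<rho>"
    and nu: "\<nu> > 0" and rho: "\<rho> > 0" and gamma: "\<gamma> \<ge> 0" and eta: "\<eta> > 0" "\<eta> \<le> 1"
    and GF: "norm (G - F) \<le> \<eta>" and gXt: "\<gamma> * norm (Xt - Xbar) \<le> \<eta>"
    and Y: "Y = X - Xbar"
begin

lemma slot_inner_le: "k \<in> \<beta> \<Longrightarrow> \<bar>\<Theta> k \<bullet> D\<bar> \<le> norm D"
  using Cauchy_Schwarz_ineq2[of "\<Theta> k" D] unit by simp

lemma noise_bound: "\<bar>\<nu> * (\<Sum>k\<in>\<beta>. N k * (\<Theta> k \<bullet> D))\<bar> \<le> \<rho> * (\<nu> * real (card \<beta>) * (\<eta> * norm D))"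
proof -
  have "\<bar>\<Sum>k\<in>\<beta>. N k * (\<Theta> k \<bullet> D)\<bar> \<le> real (card \<beta>) * (\<eta> * \<rho> * norm D)"
    using N slot_inner_le eta rho by (intro sum_mult_bound) auto
  then have "\<nu> * \<bar>\<Sum>k\<in>\<beta>. N k * (\<Theta> k \<bullet> D)\<bar> \<le> \<nu> * (real (card \<beta>) * (\<eta> * \<rho> * norm D))"
    using nu by (intro mult_left_mono) auto
  then show ?thesis using nu by (simp add: abs_mult mult_ac)
qed

text \<open>In direction \<open>-Y\<close> the loss has slope at most
  \<open>- (norm Y)\<^sup>2 / (2 * card \<beta>)\<close> apart from the noise, since every frequency
  is at least half of its limit. Noise and penalty contribute at most a multiple of
  \<open>\<rho> * norm Y\<close>; dividing by \<open>norm Y\<close> gives the rate.\<close>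

lemma estimation_error_bound:
  assumes eta2: "\<eta> \<le> 1 / (2 * real (card \<beta>))"
    and parseval: "Y \<bullet> Y = (\<Sum>k\<in>\<beta>. (\<Theta> k \<bullet> Y)\<^sup>2)"
    and fo: "0 \<le> (\<Sum>k\<in>\<beta>. p k * ((\<Theta> k \<bullet> Y) * (\<Theta> k \<bullet> (-Y)))) - \<nu> * (\<Sum>k\<in>\<beta>. N k * (\<Theta> k \<bullet> (-Y)))
       + \<rho> * ((E - G) \<bullet> (-Y) + \<gamma> * ((X - Xt) \<bullet> (-Y)))"
  shows "norm Y \<le> \<rho> * (2 * real (card \<beta>) * (\<nu> * real (card \<beta>) + norm (E - F) + 2))"
proof -
  define b where "b = real (card \<beta>)"
  have b: "b \<ge> 1" using fin ne by (simp add: b_def Suc_leI card_gt_0_iff)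
  define y where "y = norm Y"
  have y: "y \<ge> 0" by (simp add: y_def)
  have pk: "p k \<ge> 1 / (2 * b)" if "k \<in> \<beta>" for k
  proof -
    have "1 / b = 1 / (2 * b) + 1 / (2 * b)" by simp
    then show ?thesis using p[OF that] eta2 unfolding b_def[symmetric] by linarith
  qed
  have "1 / (2 * b) * y\<^sup>2 = (\<Sum>k\<in>\<beta>. 1 / (2 * b) * (\<Theta> k \<bullet> Y)\<^sup>2)"
    by (simp only: y_def power2_norm_eq_inner parseval sum_distrib_left)
  also have "\<dots> \<le> (\<Sum>k\<in>\<beta>. p k * (\<Theta> k \<bullet> Y)\<^sup>2)"
    using pk by (intro sum_mono mult_right_mono) auto
  also have "\<dots> = - (\<Sum>k\<in>\<beta>. p k * ((\<Theta> k \<bullet> Y) * (\<Theta> k \<bullet> (-Y))))"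
    by (simp add: power2_eq_square sum_negf)
  also have "\<dots> \<le> - \<nu> * (\<Sum>k\<in>\<beta>. N k * (\<Theta> k \<bullet> (-Y))) + \<rho> * ((E - G) \<bullet> (-Y) + \<gamma> * ((X - Xt) \<bullet> (-Y)))"
    using fo by simp
  also have "\<dots> \<le> \<rho> * (\<nu> * b * y) + \<rho> * ((norm (E - F) + 1) * y + y)"
  proof (intro add_mono mult_left_mono)
    have "\<rho> * (\<nu> * b * (\<eta> * y)) \<le> \<rho> * (\<nu> * b * (1 * y))"
      using rho nu b eta y by (intro mult_left_mono mult_right_mono) auto
    then show "- \<nu> * (\<Sum>k\<in>\<beta>. N k * (\<Theta> k \<bullet> (-Y))) \<le> \<rho> * (\<nu> * b * y)"
      using noise_bound[of "-Y"] by (simp add: b_def y_def abs_le_iff)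
    have "norm (E - G) \<le> norm (E - F) + 1"
      using norm_triangle_ineq[of "E - F" "F - G"] GF eta by (simp add: norm_minus_commute)
    then have "norm (E - G) * norm (-Y) \<le> (norm (E - F) + 1) * y"
      unfolding y_def by (simp add: mult_right_mono)
    then show "(E - G) \<bullet> (- Y) \<le> (norm (E - F) + 1) * y"
      using norm_cauchy_schwarz[of "E - G" "-Y"] by linarith
    \<comment> \<open>The proximal term pulls in the right direction up to the error of the initial
      estimator: its part \<open>- (Y \<bullet> Y)\<close> may be dropped.\<close>
    have "(X - Xt) \<bullet> (- Y) = - (Y \<bullet> Y) + (Xt - Xbar) \<bullet> Y"
      by (simp add: Y inner_diff_left inner_diff_right)
    also have "\<dots> \<le> norm (Xt - Xbar) * y"
      using norm_cauchy_schwarz[of "Xt - Xbar" Y] inner_ge_zero[of Y] unfolding y_def by linarith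
    finally have "\<gamma> * ((X - Xt) \<bullet> (- Y)) \<le> \<gamma> * (norm (Xt - Xbar) * y)"
      using gamma by (intro mult_left_mono)
    also have "\<dots> = (\<gamma> * norm (Xt - Xbar)) * y" by simp
    also have "\<dots> \<le> 1 * y" using gXt eta y by (intro mult_right_mono) auto
    finally show "\<gamma> * ((X - Xt) \<bullet> (- Y)) \<le> y" by simp
  qed (use rho in simp)
  finally have "y * y \<le> y * (\<rho> * (2 * b * (\<nu> * b + norm (E - F) + 2)))"
    using b by (simp add: field_simps power2_eq_square)
  moreover have "0 \<le> \<rho> * (2 * b * (\<nu> * b + norm (E - F) + 2))"
    using rho b nu by simp
  ultimately show ?thesis
    using y unfolding y_def[symmetric] b_def[symmetric] by (cases "y = 0") (auto simp: mult_le_cancel_left)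
qed

text \<open>Every contribution to the slope except the gain \<open>- \<rho> * \<delta> * s\<close>
  is nonpositive or at most \<open>\<rho> * \<eta> * norm D\<close> times a constant. With
  \<open>norm D \<le> 2 * s\<close> the assumption \<open>small\<close> makes the total slope
  negative.\<close>

lemma no_descent_direction:
  assumes B: "norm Y \<le> \<rho> * B" "B \<ge> 0"
    and orth: "(\<Sum>k\<in>\<beta>. (\<Theta> k \<bullet> Y) * (\<Theta> k \<bullet> D)) \<le> 0"
    and grho: "\<gamma> * \<rho> \<le> \<eta>"
    and D: "norm D \<le> 2 * s" "(E - F) \<bullet> D \<le> - \<delta> * s" "s > 0"
    and small: "2 * \<eta> * (real (card \<beta>) * B + \<nu> * real (card \<beta>) + B + 2) < \<delta>"
    and fo: "0 \<le> (\<Sum>k\<in>\<beta>. p k * ((\<Theta> k \<bullet> Y) * (\<Theta> k \<bullet> D))) - \<nu> * (\<Sum>k\<in>\<beta>. N k * (\<Theta> k \<bullet> D))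
       + \<rho> * ((E - G) \<bullet> D + \<gamma> * ((X - Xt) \<bullet> D))"
  shows False
proof -
  define b where "b = real (card \<beta>)"
  have b: "b \<ge> 0" by (simp add: b_def)
  define x where "x = norm D"
  have x: "x \<ge> 0" "x \<le> 2 * s" using D by (simp_all add: x_def)
  \<comment> \<open>Only the part with uniform weights \<open>1 / b\<close> has a sign, by
    \<open>orth\<close>. The deviation of the frequencies is multiplied by \<open>norm Y\<close>,
    which is already of order \<open>\<rho>\<close>.\<close>
  have "(\<Sum>k\<in>\<beta>. p k * ((\<Theta> k \<bullet> Y) * (\<Theta> k \<bullet> D)))
      = 1 / b * (\<Sum>k\<in>\<beta>. (\<Theta> k \<bullet> Y) * (\<Theta> k \<bullet> D)) + (\<Sum>k\<in>\<beta>. (p k - 1 / b) * ((\<Theta> k \<bullet> Y) * (\<Theta> k \<bullet> D)))"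
    by (simp add: sum_distrib_left sum.distrib[symmetric] algebra_simps)
  also have "\<dots> \<le> 0 + b * (\<eta> * (\<rho> * B * x))"
  proof (rule add_mono)
    show "1 / b * (\<Sum>k\<in>\<beta>. (\<Theta> k \<bullet> Y) * (\<Theta> k \<bullet> D)) \<le> 0"
      using orth b by (intro mult_nonneg_nonpos) auto
    have "\<bar>(\<Theta> k \<bullet> Y) * (\<Theta> k \<bullet> D)\<bar> \<le> \<rho> * B * x" if "k \<in> \<beta>" for k
      unfolding abs_mult x_def using slot_inner_le[OF that] B rho
      by (intro mult_mono order_trans[OF slot_inner_le[OF that] B(1)]) auto
    then have "\<bar>\<Sum>k\<in>\<beta>. (p k - 1 / b) * ((\<Theta> k \<bullet> Y) * (\<Theta> k \<bullet> D))\<bar> \<le> b * (\<eta> * (\<rho> * B * x))"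
      unfolding b_def using p eta by (intro sum_mult_bound) auto
    then show "(\<Sum>k\<in>\<beta>. (p k - 1 / b) * ((\<Theta> k \<bullet> Y) * (\<Theta> k \<bullet> D))) \<le> b * (\<eta> * (\<rho> * B * x))" by linarith
  qed
  also have "\<dots> = \<rho> * (\<eta> * x * (b * B))" by simp
  finally have 1: "(\<Sum>k\<in>\<beta>. p k * ((\<Theta> k \<bullet> Y) * (\<Theta> k \<bullet> D))) \<le> \<rho> * (\<eta> * x * (b * B))" .
  have 2: "- (\<nu> * (\<Sum>k\<in>\<beta>. N k * (\<Theta> k \<bullet> D))) \<le> \<rho> * (\<eta> * x * (\<nu> * b))"
    using noise_bound[of D] by (simp add: b_def x_def abs_le_iff mult_ac)
  have 3: "(E - G) \<bullet> D \<le> - \<delta> * s + \<eta> * x"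
  proof -
    have "(E - G) \<bullet> D = (E - F) \<bullet> D + (F - G) \<bullet> D" by (simp add: inner_diff_left)
    moreover have "(F - G) \<bullet> D \<le> norm (F - G) * x" unfolding x_def by (rule norm_cauchy_schwarz)
    moreover have "norm (F - G) * x \<le> \<eta> * x"
      using GF x by (intro mult_right_mono) (auto simp: norm_minus_commute)
    ultimately show ?thesis using D(2) by linarith
  qed
  have 4: "\<gamma> * ((X - Xt) \<bullet> D) \<le> \<eta> * x * (B + 1)"
  proof -
    have "X - Xt = Y - (Xt - Xbar)" by (simp add: Y)
    then have "norm (X - Xt) \<le> norm Y + norm (Xt - Xbar)" by (metis norm_triangle_ineq4)
    then have "norm (X - Xt) \<le> \<rho> * B + norm (Xt - Xbar)" using B by linarith
    then have "\<gamma> * norm (X - Xt) \<le> \<gamma> * (\<rho> * B + norm (Xt - Xbar))" using gamma by (intro mult_left_mono)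
    also have "\<dots> = (\<gamma> * \<rho>) * B + \<gamma> * norm (Xt - Xbar)" by (simp add: algebra_simps)
    also have "\<dots> \<le> \<eta> * B + \<eta>" using grho gXt B(2) by (intro add_mono mult_right_mono)
    finally have "\<gamma> * norm (X - Xt) * x \<le> (\<eta> * B + \<eta>) * x" using x by (intro mult_right_mono)
    moreover have "\<gamma> * ((X - Xt) \<bullet> D) \<le> \<gamma> * (norm (X - Xt) * x)"
      unfolding x_def using gamma norm_cauchy_schwarz by (intro mult_left_mono)
    ultimately show ?thesis by (simp add: algebra_simps)
  qed
  have "0 \<le> \<rho> * (\<eta> * x * (b * B)) + \<rho> * (\<eta> * x * (\<nu> * b)) + \<rho> * ((- \<delta> * s + \<eta> * x) + \<eta> * x * (B + 1))"
    using fo 1 2 mult_left_mono[OF add_mono[OF 3 4], of \<rho>] rho by linarith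
  also have "\<dots> = \<rho> * (\<eta> * x * (b * B + \<nu> * b + B + 2) - \<delta> * s)" by (simp add: algebra_simps)
  finally have "\<delta> * s \<le> x * (\<eta> * (b * B + \<nu> * b + B + 2))"
    using rho by (simp add: zero_le_mult_iff mult_ac)
  also have "\<dots> \<le> 2 * s * (\<eta> * (b * B + \<nu> * b + B + 2))"
    using x eta b nu B by (intro mult_right_mono) auto
  also have "\<dots> < s * \<delta>" using small D(3) unfolding b_def[symmetric] by (simp add: mult_ac)
  finally show False by (simp add: mult.commute)
qed

end

section \<open>Rank consistency on a deterministic good event\<close>

lemma psd_add: "psd A \<Longrightarrow> psd B \<Longrightarrow> a \<ge> 0 \<Longrightarrow> b \<ge> 0 \<Longrightarrow> psd (a *\<^sub>R A + b *\<^sub>R B)"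
  by (simp add: psd_iff hermitian_comb matrix_vector_comb inner_add_right)

lemma Sn_comb:
  assumes "A \<in> Sn rc" "B \<in> Sn rc" shows "a *\<^sub>R A + b *\<^sub>R B \<in> Sn rc"
  using assms by (auto simp: Sn_def hermitian_comb real_mat_def)

lemma orthonormal_basis_parseval:
  assumes "orthonormal_basis rc \<Theta> d" "Y \<in> Sn rc"
  shows "Y \<bullet> D = (\<Sum>k\<in>{1..d}. (\<Theta> k \<bullet> Y) * (\<Theta> k \<bullet> D))"
proof -
  have "Y = (\<Sum>k\<in>{1..d}. (\<Theta> k \<bullet> Y) *\<^sub>R \<Theta> k)"
    using assms by (simp add: orthonormal_basis_def ip_eq_inner)
  then have "Y \<bullet> D = (\<Sum>k\<in>{1..d}. (\<Theta> k \<bullet> Y) *\<^sub>R \<Theta> k) \<bullet> D" by simp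
  then show ?thesis by (simp add: inner_sum_left)
qed

text \<open>The common interface of both completion problems. \<open>C\<close> restores the
  coefficients lost with \<open>outer v\<close> and is orthogonal to every difference of feasible
  points; \<open>\<delta>\<close> is uniform in \<open>v\<close>.\<close>

definition correctable :: "bool \<Rightarrow> (nat \<Rightarrow> 'n::finite cmat) \<Rightarrow> nat set \<Rightarrow> 'n cmat \<Rightarrow> 'n cmat \<Rightarrow> real \<Rightarrow> bool" where
  "correctable rc \<Theta> \<alpha> Xbar F \<delta> \<longleftrightarrow> (\<forall>v. Xbar *v v = 0 \<longrightarrow> (\<exists>C. psd C \<and> C \<in> Sn rc \<and>
           (\<forall>k\<in>\<alpha>. \<Theta> k \<bullet> (C - outer v) = 0) \<and>
           (\<forall>Y. (\<forall>k\<in>\<alpha>. \<Theta> k \<bullet> Y = 0) \<longrightarrow> Y \<bullet> C = 0) \<and>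
           norm (C - outer v) \<le> 2 * (norm v)\<^sup>2 \<and>
           (mat 1 - F) \<bullet> (C - outer v) \<le> - \<delta> * (norm v)\<^sup>2))"

text \<open>In both cases the constraints indexed by \<open>\<alpha>\<close> are rewritten, as
  conditions on the diagonal entries in \<open>I\<close> or on the trace, and the matching
  correction lemma applies.\<close>

lemma exists_correction:
  fixes Xbar :: "'n::{finite,linorder} cmat"
  assumes psd: "psd Xbar"
    and f_nonneg: "\<And>x i. (\<forall>j. x $ j \<ge> 0) \<Longrightarrow> f x $ i \<ge> 0"
    and f_zero: "\<And>x i. (\<forall>j. x $ j \<ge> 0) \<Longrightarrow> (f x $ i = 0 \<longleftrightarrow> x $ i = 0)"
    and cases:
      "(inj_on \<Theta> {1..d} \<and> \<Theta> ` {1..d} = entry_basis realcase \<and>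
         (\<exists>I. \<alpha> = {k\<in>{1..d}. \<exists>i\<in>I. \<Theta> k = unitmat i i} \<and> (\<forall>i\<in>I. Re (Xbar $ i $ i) > 0)))
       \<or> (\<not> realcase \<and> (\<exists>k0\<in>{1..d}. \<Theta> k0 = (1 / sqrt (real CARD('n))) *\<^sub>R mat 1 \<and> \<alpha> = {k0})
          \<and> trace Xbar = 1)"
  shows "\<exists>\<delta>>0. correctable realcase \<Theta> \<alpha> Xbar (spectral_op f Xbar) \<delta>"
proof -
  let ?F = "spectral_op f Xbar"
  note F = spectral_op_kernel_diagonal[OF psd f_nonneg f_zero]
  from cases show ?thesis
  proof (elim disjE conjE exE bexE)
    fix I assume img: "\<Theta> ` {1..d} = entry_basis realcase"
      and \<alpha>: "\<alpha> = {k\<in>{1..d}. \<exists>i\<in>I. \<Theta> k = unitmat i i}" and pos: "\<forall>i\<in>I. Re (Xbar $ i $ i) > 0"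
    have *: "(\<forall>k\<in>\<alpha>. \<Theta> k \<bullet> Z = 0) \<longleftrightarrow> (\<forall>i\<in>I. unitmat i i \<bullet> Z = 0)" for Z
    proof
      assume "\<forall>k\<in>\<alpha>. \<Theta> k \<bullet> Z = 0"
      moreover have "\<exists>k\<in>\<alpha>. \<Theta> k = unitmat i i" if "i \<in> I" for i
      proof -
        have "unitmat i i \<in> \<Theta> ` {1..d}" unfolding img entry_basis_def by blast
        then show ?thesis using that \<alpha> by force
      qed
      ultimately show "\<forall>i\<in>I. unitmat i i \<bullet> Z = 0" by metis
    qed (auto simp: \<alpha>)
    have "\<And>i. i \<in> I \<Longrightarrow> Re (?F $ i $ i) > 0" using F(3) pos by blast
    from correction_diagonal[where I = I and rc = realcase, OF this F(1)] show ?thesis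
      unfolding correctable_def * by blast
  next
    fix k0 assume k0: "\<Theta> k0 = (1 / sqrt (real CARD('n))) *\<^sub>R mat 1" "\<alpha> = {k0}" and tr: "trace Xbar = 1"
    have *: "(\<forall>k\<in>\<alpha>. \<Theta> k \<bullet> Z = 0) \<longleftrightarrow> mat 1 \<bullet> Z = 0" for Z
      using k0 by simp
    \<comment> \<open>Trace 1 forces a positive diagonal entry of \<open>Xbar\<close>, hence one of
      \<open>?F\<close>, whose other diagonal entries are nonnegative.\<close>
    have "(\<Sum>i\<in>UNIV. Re (Xbar $ i $ i)) = 1" using arg_cong[OF tr, of Re] by (simp add: trace_def)
    then have "\<not> (\<forall>i. Re (Xbar $ i $ i) \<le> 0)"
      using sum_nonpos[of UNIV "\<lambda>i. Re (Xbar $ i $ i)"] by fastforce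
    then obtain i where "Re (Xbar $ i $ i) > 0" by (auto simp: not_le)
    then have "(\<Sum>i\<in>UNIV. Re (?F $ i $ i)) > 0"
      using F(2,3) by (intro sum_pos2[of UNIV i]) auto
    then have "mat 1 \<bullet> ?F > 0" by (simp add: inner_mat_1)
    from correction_trace[where rc = realcase, OF this F(1)] show ?thesis
      unfolding correctable_def * by blast
  qed
qed

text \<open>The tolerance \<open>\<eta>\<close> is fixed before the sample size and the data, so
  only the probability of violating the listed inequalities remains to be estimated.\<close>

lemma rank_consistent_on_good_event:
  fixes Xbar F :: "'n::finite cmat"
  assumes basis: "orthonormal_basis rc \<Theta> d" and \<alpha>: "\<alpha> \<subseteq> {1..d}" and \<beta>: "\<beta> = {1..d} - \<alpha>"
    and Xbar: "Xbar \<in> Sn rc" "psd Xbar" and nu: "\<nu> > 0"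
    and corr: "correctable rc \<Theta> \<alpha> Xbar F \<delta>" "\<delta> > 0"
  shows "\<exists>\<eta>>0. \<forall>m w z \<rho> \<gamma> Xt G X. (\<forall>i. w i \<in> \<beta>) \<longrightarrow>
      (\<forall>k\<in>\<beta>. \<bar>slot_avg w m (\<lambda>_. 1) k - 1 / real (card \<beta>)\<bar> \<le> \<eta>) \<longrightarrow>
      (\<forall>k\<in>\<beta>. \<bar>slot_avg w m z k\<bar> \<le> \<eta> * \<rho>) \<longrightarrow> \<rho> > 0 \<longrightarrow> \<rho> \<le> \<eta> \<longrightarrow> \<gamma> \<ge> 0 \<longrightarrow> \<gamma> * \<rho> \<le> \<eta> \<longrightarrow>
      norm (G - F) \<le> \<eta> \<longrightarrow> \<gamma> * norm (Xt - Xbar) \<le> \<eta> \<longrightarrow>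
      is_opt (rc_objective \<Theta> Xbar \<nu> w z m \<rho> \<gamma> Xt G) (rc_feasible rc \<Theta> \<alpha> Xbar) X \<longrightarrow>
      rank X = rank Xbar"
proof -
  define b where "b = real (card \<beta>)"
  \<comment> \<open>\<open>B\<close> is the constant of \<open>estimation_error_bound\<close>, and
    \<open>K\<close> collects the error terms of \<open>no_descent_direction\<close>.\<close>
  define B where "B = 2 * b * (\<nu> * b + norm (mat 1 - F) + 2)"
  define K where "K = 2 * (b * B + \<nu> * b + B + 2)"
  have b: "b \<ge> 0" by (simp add: b_def)
  have B: "B \<ge> 0" using b nu by (simp add: B_def)
  have K: "K > 0" using b B nu by (simp add: K_def add_nonneg_pos)
  obtain c where c: "c > 0" "\<And>Z. norm (Z - Xbar) < c \<Longrightarrow> rank Xbar \<le> rank Z"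
    using rank_lower_semicontinuous[of Xbar] Xbar(2) psd_iff by blast
  \<comment> \<open>In order: the general bound 1, frequencies at least half of uniform, a strictly
    negative slope, and \<open>X\<close> within the radius where the rank cannot drop. The added 1
    in two denominators covers \<open>b = 0\<close> and \<open>B = 0\<close>.\<close>
  define \<eta> where "\<eta> = Min {1, 1 / (2 * b + 1), \<delta> / (2 * K), c / (2 * (B + 1))}"
  have eta: "\<eta> > 0" "\<eta> \<le> 1" "\<eta> \<le> 1 / (2 * b + 1)" "\<eta> \<le> \<delta> / (2 * K)" "\<eta> \<le> c / (2 * (B + 1))"
    using b B K corr(2) c(1) by (auto simp: \<eta>_def)
  have etaK: "\<eta> * K < \<delta>"
  proof -
    have "\<eta> * K \<le> \<delta> / (2 * K) * K" using eta K by (intro mult_right_mono) auto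
    also have "\<dots> < \<delta>" using K corr(2) by simp
    finally show ?thesis .
  qed
  have etaB: "\<eta> * B < c"
  proof -
    have "\<eta> * B \<le> c / (2 * (B + 1)) * (B + 1)" using eta B c by (intro mult_mono) auto
    also have "\<dots> = c / 2" using B by (simp add: field_simps)
    also have "\<dots> < c" using c(1) by simp
    finally show ?thesis .
  qed
  show ?thesis
  proof (rule exI[of _ \<eta>], intro conjI allI impI eta(1))
    fix m w z \<rho> \<gamma> and Xt G X :: "'n cmat"
    assume w: "\<forall>i. w i \<in> \<beta>"
      and p: "\<forall>k\<in>\<beta>. \<bar>slot_avg w m (\<lambda>_. 1) k - 1 / real (card \<beta>)\<bar> \<le> \<eta>"
      and N: "\<forall>k\<in>\<beta>. \<bar>slot_avg w m z k\<bar> \<le> \<eta> * \<rho>"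
      and rho: "\<rho> > 0" "\<rho> \<le> \<eta>" and gamma: "\<gamma> \<ge> 0" "\<gamma> * \<rho> \<le> \<eta>"
      and GF: "norm (G - F) \<le> \<eta>" and gXt: "\<gamma> * norm (Xt - Xbar) \<le> \<eta>"
      and opt: "is_opt (rc_objective \<Theta> Xbar \<nu> w z m \<rho> \<gamma> Xt G) (rc_feasible rc \<Theta> \<alpha> Xbar) X"
    have fin: "finite \<beta>" by (simp add: \<beta>)
    have ne: "\<beta> \<noteq> {}" using w by blast
    then have b1: "b \<ge> 1" using fin by (simp add: b_def Suc_leI card_gt_0_iff)
    have unit: "norm (\<Theta> k) = 1" if "k \<in> \<beta>" for k
    proof -
      have "ip (\<Theta> k) (\<Theta> k) = 1" using basis that by (auto simp: orthonormal_basis_def \<beta>)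
      then show ?thesis by (simp add: ip_eq_inner norm_eq_1)
    qed
    define Y where "Y = X - Xbar"
    have X: "X \<in> Sn rc" "psd X" and X\<alpha>: "\<And>k. k \<in> \<alpha> \<Longrightarrow> \<Theta> k \<bullet> X = \<Theta> k \<bullet> Xbar"
      using opt by (auto simp: is_opt_def rc_feasible_def ip_eq_inner)
    have YS: "Y \<in> Sn rc" using Sn_comb[OF X(1) Xbar(1), of 1 "-1"] by (simp add: Y_def)
    have Y\<alpha>: "\<Theta> k \<bullet> Y = 0" if "k \<in> \<alpha>" for k using X\<alpha>[OF that] by (simp add: Y_def inner_diff_right)
    \<comment> \<open>The coefficients of \<open>Y\<close> in \<open>\<alpha>\<close> vanish by
      feasibility, so the expansion runs over the sampled indices only.\<close>
    have parseval: "Y \<bullet> D = (\<Sum>k\<in>\<beta>. (\<Theta> k \<bullet> Y) * (\<Theta> k \<bullet> D))" for D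
      unfolding orthonormal_basis_parseval[OF basis YS] \<beta>
      using Y\<alpha> by (intro sum.mono_neutral_right) auto
    have fo: "0 \<le> (\<Sum>k\<in>\<beta>. slot_avg w m (\<lambda>_. 1) k * ((\<Theta> k \<bullet> Y) * (\<Theta> k \<bullet> D)))
         - \<nu> * (\<Sum>k\<in>\<beta>. slot_avg w m z k * (\<Theta> k \<bullet> D))
         + \<rho> * ((mat 1 - G) \<bullet> D + \<gamma> * ((X - Xt) \<bullet> D))"
      if "t0 > 0" and "\<And>t. 0 < t \<Longrightarrow> t \<le> t0 \<Longrightarrow> X + t *\<^sub>R D \<in> rc_feasible rc \<Theta> \<alpha> Xbar" for D t0
    proof -
      have wi: "\<And>i. w i \<in> \<beta>" using w by blast
      have "1 / real m * (\<Sum>i\<in>{1..m}. (\<Theta> (w i) \<bullet> Y - \<nu> * z i) * (\<Theta> (w i) \<bullet> D))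
        = 1 / real m * (\<Sum>i\<in>{1..m}. 1 * ((\<Theta> (w i) \<bullet> Y) * (\<Theta> (w i) \<bullet> D)))
          - \<nu> * (1 / real m * (\<Sum>i\<in>{1..m}. z i * (\<Theta> (w i) \<bullet> D)))"
        by (simp add: sum_distrib_left sum_subtractf[symmetric] left_diff_distrib right_diff_distrib mult_ac)
      also have "\<dots> = (\<Sum>k\<in>\<beta>. slot_avg w m (\<lambda>_. 1) k * ((\<Theta> k \<bullet> Y) * (\<Theta> k \<bullet> D)))
         - \<nu> * (\<Sum>k\<in>\<beta>. slot_avg w m z k * (\<Theta> k \<bullet> D))"
        unfolding average_by_slots[OF fin wi, of m "\<lambda>_. 1" "\<lambda>k. (\<Theta> k \<bullet> Y) * (\<Theta> k \<bullet> D)"]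
          average_by_slots[OF fin wi, of m z "\<lambda>k. \<Theta> k \<bullet> D"] ..
      finally show ?thesis using first_order_optimality[OF opt that] unfolding Y_def by simp
    qed
      have p': "\<And>k. k \<in> \<beta> \<Longrightarrow> \<bar>slot_avg w m (\<lambda>_. 1) k - 1 / real (card \<beta>)\<bar> \<le> \<eta>"
        and N': "\<And>k. k \<in> \<beta> \<Longrightarrow> \<bar>slot_avg w m z k\<bar> \<le> \<eta> * \<rho>" using p N by auto
    have bound: "norm Y \<le> \<rho> * B"
      unfolding B_def b_def
    proof (rule estimation_error_bound[OF fin ne unit p' N' nu rho(1) gamma(1) eta(1,2) GF gXt Y_def])
      have "1 / (2 * b + 1) \<le> 1 / (2 * b)" using b1 by (intro divide_left_mono) auto
      then show "\<eta> \<le> 1 / (2 * real (card \<beta>))" using eta(3) unfolding b_def[symmetric] by linarith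
      show "Y \<bullet> Y = (\<Sum>k\<in>\<beta>. (\<Theta> k \<bullet> Y)\<^sup>2)" by (simp add: parseval power2_eq_square)
      show "0 \<le> (\<Sum>k\<in>\<beta>. slot_avg w m (\<lambda>_. 1) k * ((\<Theta> k \<bullet> Y) * (\<Theta> k \<bullet> - Y)))
         - \<nu> * (\<Sum>k\<in>\<beta>. slot_avg w m z k * (\<Theta> k \<bullet> - Y))
         + \<rho> * ((mat 1 - G) \<bullet> - Y + \<gamma> * ((X - Xt) \<bullet> - Y))"
      proof (rule fo[of 1])
        fix t :: real assume t: "0 < t" "t \<le> 1"
        have "X + t *\<^sub>R (- Y) = (1 - t) *\<^sub>R X + t *\<^sub>R Xbar" by (simp add: Y_def algebra_simps)
        moreover have "\<dots> \<in> rc_feasible rc \<Theta> \<alpha> Xbar"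
          unfolding rc_feasible_def
        proof (intro CollectI conjI ballI)
          show "(1 - t) *\<^sub>R X + t *\<^sub>R Xbar \<in> Sn rc" using X Xbar by (intro Sn_comb)
          show "psd ((1 - t) *\<^sub>R X + t *\<^sub>R Xbar)" using X Xbar t by (intro psd_add) auto
          fix k assume "k \<in> \<alpha>"
          from X\<alpha>[OF this] show "ip (\<Theta> k) ((1 - t) *\<^sub>R X + t *\<^sub>R Xbar) = ip (\<Theta> k) Xbar"
            by (simp add: ip_eq_inner inner_add_right algebra_simps)
        qed
        ultimately show "X + t *\<^sub>R (- Y) \<in> rc_feasible rc \<Theta> \<alpha> Xbar" by simp
      qed simp
    qed
    have "rank Xbar \<le> rank X"
    proof (rule c(2))
      have "\<rho> * B \<le> \<eta> * B" using rho B by (intro mult_right_mono) auto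
      then show "norm (X - Xbar) < c" using bound etaB by (simp add: Y_def)
    qed
    moreover have "\<not> rank Xbar < rank X"
    proof
      assume "rank Xbar < rank X"
      from rank_less_kernel_vector[OF Xbar(1) X(1) this] obtain u where
        u: "X *v u \<noteq> 0" "Xbar *v (X *v u) = 0" "rc \<longrightarrow> (\<forall>i. Im ((X *v u) $ i) = 0)" by blast
      define v where "v = X *v u"
      obtain C where C: "psd C" "C \<in> Sn rc" and C\<alpha>: "\<forall>k\<in>\<alpha>. \<Theta> k \<bullet> (C - outer v) = 0"
        and YC: "\<forall>Y. (\<forall>k\<in>\<alpha>. \<Theta> k \<bullet> Y = 0) \<longrightarrow> Y \<bullet> C = 0"
        and nC: "norm (C - outer v) \<le> 2 * (norm v)\<^sup>2"
        and dC: "(mat 1 - F) \<bullet> (C - outer v) \<le> - \<delta> * (norm v)\<^sup>2"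
        using corr(1) u(2) unfolding correctable_def v_def by blast
      obtain t0 where t0: "t0 > 0" "\<And>t. 0 \<le> t \<Longrightarrow> t \<le> t0 \<Longrightarrow> psd (X - t *\<^sub>R outer v)"
        using psd_minus_outer[OF X(2), of u] unfolding v_def by blast
      have feas: "X + t *\<^sub>R (C - outer v) \<in> rc_feasible rc \<Theta> \<alpha> Xbar" if t: "0 < t" "t \<le> t0" for t
      proof -
        \<comment> \<open>Regrouped as a sum of two positive semidefinite matrices in
          \<open>Sn rc\<close>.\<close>
        have eq: "X + t *\<^sub>R (C - outer v) = 1 *\<^sub>R (X - t *\<^sub>R outer v) + t *\<^sub>R C"
          by (simp add: algebra_simps)
        have oS: "outer v \<in> Sn rc" using u(3) by (intro outer_Sn) (simp add: v_def)
        have "X - t *\<^sub>R outer v \<in> Sn rc" using Sn_comb[OF X(1) oS, of 1 "-t"] by simp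
        then have "X + t *\<^sub>R (C - outer v) \<in> Sn rc" unfolding eq using C(2) by (intro Sn_comb)
        moreover have "psd (X + t *\<^sub>R (C - outer v))"
          unfolding eq using t t0(2) C(1) by (intro psd_add) auto
        ultimately show ?thesis
          using X\<alpha> C\<alpha> by (simp add: rc_feasible_def ip_eq_inner inner_add_right)
      qed
      have "Y \<bullet> (C - outer v) \<le> 0"
      proof -
        have "Y \<bullet> C = 0" using YC Y\<alpha> by blast
        moreover have "Y \<bullet> outer v = v \<bullet> (X *v v)"
          using u(2) by (simp add: inner_outer Y_def matrix_vector_mult_diff_rdistrib v_def)
        moreover have "v \<bullet> (X *v v) \<ge> 0" using X(2) psd_iff by blast
        ultimately show ?thesis by (simp add: inner_diff_right)
      qed
      then have orth: "(\<Sum>k\<in>\<beta>. (\<Theta> k \<bullet> Y) * (\<Theta> k \<bullet> (C - outer v))) \<le> 0" by (simp only: parseval)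
      have v: "(norm v)\<^sup>2 > 0" using u(1) by (simp add: v_def)
      have small: "2 * \<eta> * (real (card \<beta>) * B + \<nu> * real (card \<beta>) + B + 2) < \<delta>"
        using etaK by (simp add: K_def b_def mult_ac)
      show False
        by (rule no_descent_direction[OF fin ne unit p' N' nu rho(1) gamma(1) eta(1,2) GF gXt Y_def
              bound B orth gamma(2) nC dC v small fo[OF t0(1) feas]])
    qed
    ultimately show "rank X = rank Xbar" by simp
  qed
qed

section \<open>Tail bounds\<close>

context prob_space
begin

lemma indep_centered_orthogonal:
  fixes U :: "nat \<Rightarrow> 'a \<Rightarrow> real"
  assumes indep: "indep_vars (\<lambda>_. borel) U UNIV" and int: "\<And>i. integrable M (U i)"
    and mean: "\<And>i. expectation (U i) = 0" and ij: "i \<noteq> j"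
  shows "integrable M (\<lambda>x. U i x * U j x)" "expectation (\<lambda>x. U i x * U j x) = 0"
proof -
  have ind: "indep_vars (\<lambda>_. borel) U {i, j}" using indep indep_vars_subset by blast
  have eq: "(\<Prod>k\<in>{i, j}. U k x) = U i x * U j x" for x using ij by simp
  show "integrable M (\<lambda>x. U i x * U j x)"
    using indep_vars_integrable[OF _ ind int] eq by simp
  show "expectation (\<lambda>x. U i x * U j x) = 0"
    using indep_vars_lebesgue_integral[OF _ ind int] eq mean by (simp add: card_gt_0_iff)
qed

text \<open>Chebyshev's inequality: orthogonality collapses the double sum to its diagonal, so the
  second moment of the average is at most \<open>1 / m\<close>. Orthogonality in place of
  independence suits both the centred indicators and the noise collected at a slot.\<close>

lemma orthogonal_average_tail:
  fixes U :: "nat \<Rightarrow> 'a \<Rightarrow> real"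
  assumes int: "\<And>i j. integrable M (\<lambda>x. U i x * U j x)"
    and orth: "\<And>i j. i \<noteq> j \<Longrightarrow> expectation (\<lambda>x. U i x * U j x) = 0"
    and var: "\<And>i. expectation (\<lambda>x. U i x * U i x) \<le> 1"
    and meas: "\<And>i. U i \<in> borel_measurable M"
    and m: "m \<ge> 1" and a: "a > 0"
  shows "prob {x\<in>space M. \<bar>1 / real m * (\<Sum>i\<in>{1..m}. U i x)\<bar> > a} \<le> 1 / (real m * a\<^sup>2)"
proof -
  note [measurable] = meas
  let ?S = "\<lambda>x. 1 / real m * (\<Sum>i\<in>{1..m}. U i x)"
  have sq: "(?S x)\<^sup>2 = 1 / (real m)\<^sup>2 * (\<Sum>i\<in>{1..m}. \<Sum>j\<in>{1..m}. U i x * U j x)" for x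
    by (simp add: power2_eq_square sum_product)
  have int_sq: "integrable M (\<lambda>x. (?S x)\<^sup>2)" unfolding sq using int by simp
  have "expectation (\<lambda>x. (?S x)\<^sup>2)
      = 1 / (real m)\<^sup>2 * (\<Sum>i\<in>{1..m}. \<Sum>j\<in>{1..m}. expectation (\<lambda>x. U i x * U j x))"
    unfolding sq using int by (simp add: Bochner_Integration.integral_sum)
  also have "(\<Sum>i\<in>{1..m}. \<Sum>j\<in>{1..m}. expectation (\<lambda>x. U i x * U j x))
     = (\<Sum>i\<in>{1..m}. \<Sum>j\<in>{1..m}. if j = i then expectation (\<lambda>x. U i x * U i x) else 0)"
    using orth by (intro sum.cong refl) auto
  also have "\<dots> = (\<Sum>i\<in>{1..m}. expectation (\<lambda>x. U i x * U i x))" by simp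
  also have "1 / (real m)\<^sup>2 * \<dots> \<le> 1 / (real m)\<^sup>2 * (\<Sum>i\<in>{1..m}. 1)"
    using var by (intro mult_left_mono sum_mono) auto
  also have "\<dots> = 1 / real m" using m by (simp add: power2_eq_square)
  finally have E: "expectation (\<lambda>x. (?S x)\<^sup>2) \<le> 1 / real m" .
  have "prob {x\<in>space M. \<bar>?S x\<bar> > a} \<le> prob {x\<in>space M. (?S x)\<^sup>2 \<ge> a\<^sup>2}"
  proof (rule finite_measure_mono)
    have "a\<^sup>2 \<le> (?S x)\<^sup>2" if "\<bar>?S x\<bar> > a" for x
      using that a by (intro abs_le_square_iff[THEN iffD1]) simp
    then show "{x\<in>space M. \<bar>?S x\<bar> > a} \<subseteq> {x\<in>space M. (?S x)\<^sup>2 \<ge> a\<^sup>2}" by blast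
  qed measurable
  also have "\<dots> \<le> expectation (\<lambda>x. (?S x)\<^sup>2) / a\<^sup>2"
    using a by (intro integral_Markov_inequality_measure[OF int_sq, of "{}"]) auto
  also have "\<dots> \<le> (1 / real m) / a\<^sup>2" using E by (intro divide_right_mono) auto
  finally show ?thesis by simp
qed

lemma slot_frequency_tail:
  fixes \<omega> :: "nat \<Rightarrow> 'a \<Rightarrow> nat"
  assumes indep: "indep_vars (\<lambda>_. count_space UNIV) \<omega> UNIV"
    and unif: "\<And>i. prob {x\<in>space M. \<omega> i x = k} = q"
    and m: "m \<ge> 1" and a: "a > 0"
  shows "prob {x\<in>space M. \<bar>slot_avg (\<lambda>i. \<omega> i x) m (\<lambda>_. 1) k - q\<bar> > a} \<le> 1 / (real m * a\<^sup>2)"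
proof -
  define U where "U = (\<lambda>i x. (if \<omega> i x = k then 1 else 0) - q)"
  have meas_\<omega>[measurable]: "\<omega> i \<in> measurable M (count_space UNIV)" for i
    using indep by (simp add: indep_vars_def)
  have q: "0 \<le> q" "q \<le> 1" using unif[of 0] prob_le_1 measure_nonneg by metis+
  have meas[measurable]: "U i \<in> borel_measurable M" for i unfolding U_def by measurable
  have bnd: "\<bar>U i x\<bar> \<le> 1" for i x using q by (auto simp: U_def)
  have int: "integrable M (U i)" for i
    by (rule integrable_const_bound[of _ 1]) (use bnd in auto)
  have ind: "indep_vars (\<lambda>_. borel) U UNIV"
    unfolding U_def
    by (rule indep_vars_compose2[OF indep, of "\<lambda>_ n. (if n = k then 1 else 0) - q" "\<lambda>_. borel"]) simp
  have mean: "expectation (U i) = 0" for i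
  proof -
    have "expectation (U i) = expectation (\<lambda>x. indicator {x\<in>space M. \<omega> i x = k} x - q)"
      by (intro Bochner_Integration.integral_cong) (auto simp: U_def)
    also have "\<dots> = prob {x\<in>space M. \<omega> i x = k} - q"
      by (subst Bochner_Integration.integral_diff)
        (auto simp: prob_space emeasure_eq_measure intro!: integrable_real_indicator)
    finally show ?thesis by (simp add: unif)
  qed
  have prod: "\<bar>U i x * U j x\<bar> \<le> 1" for i j x
    unfolding abs_mult using bnd[of i x] bnd[of j x] by (intro mult_le_one) auto
  have int2: "integrable M (\<lambda>x. U i x * U j x)" for i j
    by (rule integrable_const_bound[of _ 1]) (use prod in auto)
  have "expectation (\<lambda>x. U i x * U i x) \<le> 1" for i
  proof -
    have "expectation (\<lambda>x. U i x * U i x) \<le> expectation (\<lambda>x. 1)"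
      using prod[of i _ i] by (intro integral_mono int2) (auto simp: abs_le_iff)
    then show ?thesis by (simp add: prob_space)
  qed
  moreover have "expectation (\<lambda>x. U i x * U j x) = 0" if "i \<noteq> j" for i j
    by (rule indep_centered_orthogonal(2)[OF ind int mean that])
  ultimately have tail: "prob {x\<in>space M. \<bar>1 / real m * (\<Sum>i\<in>{1..m}. U i x)\<bar> > a} \<le> 1 / (real m * a\<^sup>2)"
    by (intro orthogonal_average_tail int2 meas m a)
  have "1 / real m * (\<Sum>i\<in>{1..m}. U i x) = slot_avg (\<lambda>i. \<omega> i x) m (\<lambda>_. 1) k - q" for x
    using m by (simp add: U_def slot_avg_def sum_subtractf right_diff_distrib)
  then show ?thesis using tail by simp
qed

text \<open>Needed to factor the mixed moments of the collected noise: products over two indices are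
  measurable with respect to the sigma-algebras of their families, so they inherit
  independence.\<close>

lemma indep_var_of_families_indep:
  fixes \<omega> :: "nat \<Rightarrow> 'a \<Rightarrow> nat" and \<xi> :: "nat \<Rightarrow> 'a \<Rightarrow> real"
  assumes fam: "families_indep M \<omega> \<xi>"
    and \<omega>: "\<And>i. \<omega> i \<in> measurable M (count_space UNIV)" and \<xi>: "\<And>i. \<xi> i \<in> borel_measurable M"
  shows "indep_var borel (\<lambda>x. h1 (\<omega> i x) * h2 (\<omega> j x) :: real) borel (\<lambda>x. \<xi> i x * \<xi> j x)"
proof -
  define A where "A = {\<omega> i -` A \<inter> space M | i A. True}"
  define B where "B = {\<xi> i -` B \<inter> space M | i B. B \<in> sets (borel::real measure)}"
  \<comment> \<open>\<open>MA\<close> and \<open>MB\<close> are the original space with the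
    sigma-algebras generated by each family; measurability with respect to them yields the required
    inclusions.\<close>
  define MA where "MA = sigma (space M) A"
  define MB where "MB = sigma (space M) B"
  have AB: "A \<subseteq> Pow (space M)" "B \<subseteq> Pow (space M)" by (auto simp: A_def B_def)
  have sp: "space MA = space M" "space MB = space M" by (simp_all add: MA_def MB_def AB space_measure_of)
  have st: "sets MA = sigma_sets (space M) A" "sets MB = sigma_sets (space M) B"
    by (simp_all add: MA_def MB_def AB sets_measure_of)
  have [measurable]: "\<omega> i \<in> measurable MA (count_space UNIV)" for i
    by (rule measurableI) (auto simp: sp st A_def intro!: sigma_sets.Basic)
  have [measurable]: "\<xi> i \<in> measurable MB borel" for i
    by (rule measurableI) (auto simp: sp st B_def intro!: sigma_sets.Basic)
  let ?X = "\<lambda>x. h1 (\<omega> i x) * h2 (\<omega> j x)" and ?Y = "\<lambda>x. \<xi> i x * \<xi> j x"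
  have X: "?X \<in> borel_measurable MA" by measurable
  have Y: "?Y \<in> borel_measurable MB" by measurable
  have "{?X -` S \<inter> space M | S. S \<in> sets borel} \<subseteq> sets MA"
    using measurable_sets[OF X] by (auto simp: sp)
  then have 1: "sigma_sets (space M) {?X -` S \<inter> space M | S. S \<in> sets borel} \<subseteq> sigma_sets (space M) A"
    unfolding st by (rule sigma_sets_mono)
  have "{?Y -` S \<inter> space M | S. S \<in> sets borel} \<subseteq> sets MB"
    using measurable_sets[OF Y] by (auto simp: sp)
  then have 2: "sigma_sets (space M) {?Y -` S \<inter> space M | S. S \<in> sets borel} \<subseteq> sigma_sets (space M) B"
    unfolding st by (rule sigma_sets_mono)
  note [measurable] = \<omega> \<xi>
  have rv: "random_variable borel ?X" "random_variable borel ?Y" by measurable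
  have "indep_set (sigma_sets (space M) A) (sigma_sets (space M) B)"
    using fam by (simp add: families_indep_def A_def B_def)
  then have "indep_set (sigma_sets (space M) {?X -` S \<inter> space M | S. S \<in> sets borel})
     (sigma_sets (space M) {?Y -` S \<inter> space M | S. S \<in> sets borel})"
    unfolding indep_set_def by (rule indep_sets_mono_sets) (use 1 2 in \<open>auto split: bool.split\<close>)
  then show ?thesis using rv by (simp only: indep_var_eq)
qed

text \<open>The mixed moment of two summands factors into an indicator moment and a noise moment.
  The latter is 0 for distinct indices; on the diagonal the product is at most 1.\<close>

lemma slot_noise_tail:
  fixes \<omega> :: "nat \<Rightarrow> 'a \<Rightarrow> nat" and \<xi> :: "nat \<Rightarrow> 'a \<Rightarrow> real"
  assumes \<omega>_meas: "\<And>i. \<omega> i \<in> measurable M (count_space UNIV)"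
    and \<xi>_indep: "indep_vars (\<lambda>_. borel) \<xi> UNIV"
    and \<xi>_ident: "\<And>i. distr M borel (\<xi> i) = distr M borel (\<xi> 0)"
    and \<xi>_int: "integrable M (\<xi> 0)" and \<xi>_mean: "expectation (\<xi> 0) = 0"
    and \<xi>_sq_int: "integrable M (\<lambda>x. (\<xi> 0 x)\<^sup>2)" and \<xi>_var: "expectation (\<lambda>x. (\<xi> 0 x)\<^sup>2) = 1"
    and fam: "families_indep M \<omega> \<xi>"
    and m: "m \<ge> 1" and a: "a > 0"
  shows "prob {x\<in>space M. \<bar>slot_avg (\<lambda>i. \<omega> i x) m (\<lambda>i. \<xi> i x) k\<bar> > a} \<le> 1 / (real m * a\<^sup>2)"
proof -
  have \<xi>_meas: "\<xi> i \<in> borel_measurable M" for i using \<xi>_indep by (simp add: indep_vars_def)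
  note [measurable] = \<omega>_meas \<xi>_meas
  \<comment> \<open>Moments are given for index 0 only and pass to all indices through equality of
    distributions.\<close>
  have transfer: "integrable M (\<lambda>x. g (\<xi> i x)) \<longleftrightarrow> integrable M (\<lambda>x. g (\<xi> 0 x))"
    "expectation (\<lambda>x. g (\<xi> i x)) = expectation (\<lambda>x. g (\<xi> 0 x))"
    if "g \<in> borel_measurable borel" for g :: "real \<Rightarrow> real" and i
  proof -
    have "integrable (distr M borel (\<xi> j)) g \<longleftrightarrow> integrable M (\<lambda>x. g (\<xi> j x))" for j
      using that by (intro integrable_distr_eq) auto
    then show "integrable M (\<lambda>x. g (\<xi> i x)) \<longleftrightarrow> integrable M (\<lambda>x. g (\<xi> 0 x))"
      using \<xi>_ident[of i] by metis
    have "integral\<^sup>L (distr M borel (\<xi> j)) g = expectation (\<lambda>x. g (\<xi> j x))" for j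
      using that by (intro integral_distr) auto
    then show "expectation (\<lambda>x. g (\<xi> i x)) = expectation (\<lambda>x. g (\<xi> 0 x))"
      using \<xi>_ident[of i] by metis
  qed
  have int: "integrable M (\<xi> i)" and mean: "expectation (\<xi> i) = 0" for i
    using transfer[of "\<lambda>y. y" i] \<xi>_int \<xi>_mean by auto
  have sq_int: "integrable M (\<lambda>x. (\<xi> i x)\<^sup>2)" and var: "expectation (\<lambda>x. (\<xi> i x)\<^sup>2) = 1" for i
    using transfer[of "\<lambda>y. y\<^sup>2" i] \<xi>_sq_int \<xi>_var by auto
  have int2: "integrable M (\<lambda>x. \<xi> i x * \<xi> j x)" for i j
    using indep_centered_orthogonal(1)[OF \<xi>_indep int mean, of i j] sq_int[of i]
    by (cases "i = j") (auto simp: power2_eq_square)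
  define I where "I = (\<lambda>n. if n = k then 1 else 0 :: real)"
  define U where "U = (\<lambda>i x. \<xi> i x * I (\<omega> i x))"
  have meas: "U i \<in> borel_measurable M" for i unfolding U_def I_def by measurable
  have split: "U i x * U j x = (I (\<omega> i x) * I (\<omega> j x)) * (\<xi> i x * \<xi> j x)" for i j x by (simp add: U_def)
  have iv: "indep_var borel (\<lambda>x. I (\<omega> i x) * I (\<omega> j x)) borel (\<lambda>x. \<xi> i x * \<xi> j x)" for i j
    by (rule indep_var_of_families_indep[OF fam \<omega>_meas \<xi>_meas])
  have intI: "integrable M (\<lambda>x. I (\<omega> i x) * I (\<omega> j x))" for i j
    by (rule integrable_const_bound[of _ 1]) (auto simp: I_def)
  have intU: "integrable M (\<lambda>x. U i x * U j x)" for i j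
    unfolding split by (rule indep_var_integrable[OF iv intI int2])
  have EU: "expectation (\<lambda>x. U i x * U j x)
      = expectation (\<lambda>x. I (\<omega> i x) * I (\<omega> j x)) * expectation (\<lambda>x. \<xi> i x * \<xi> j x)" for i j
    unfolding split by (rule indep_var_lebesgue_integral[OF iv intI int2])
  have orth: "expectation (\<lambda>x. U i x * U j x) = 0" if "i \<noteq> j" for i j
    unfolding EU using indep_centered_orthogonal(2)[OF \<xi>_indep int mean that] by simp
  have "expectation (\<lambda>x. U i x * U i x) \<le> 1" for i
  proof -
    have "expectation (\<lambda>x. I (\<omega> i x) * I (\<omega> i x)) \<le> expectation (\<lambda>x. 1)"
      by (intro integral_mono intI) (auto simp: I_def)
    then show ?thesis unfolding EU using var[of i] by (simp add: power2_eq_square prob_space)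
  qed
  note tail = orthogonal_average_tail[OF intU orth this meas m a]
  then show ?thesis by (simp add: U_def I_def slot_avg_def)
qed

end

text \<open>By lower semicontinuity, \<open>{A. k \<le> rank A}\<close> agrees on Hermitian matrices
  with the open set \<open>U k\<close>, a union of balls on which the rank is at least
  \<open>k\<close>. Measurability is what allows the probability of the rank event to be bounded
  below.\<close>

lemma rank_level_set_measurable:
  fixes Z :: "'a \<Rightarrow> 'n::finite cmat"
  assumes [measurable]: "Z \<in> borel_measurable M" and herm: "\<And>x. x \<in> space M \<Longrightarrow> hermitian (Z x)"
  shows "{x\<in>space M. rank (Z x) = r} \<in> sets M"
proof -
  define U where "U k = \<Union>{ball A c | (A :: 'n cmat) c. \<forall>B\<in>ball A c. k \<le> rank B}" for k
  have [measurable]: "U k \<in> sets borel" for k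
    by (intro borel_open) (auto simp: U_def)
  have U: "A \<in> U k \<longleftrightarrow> k \<le> rank A" if A: "hermitian A" for A k
  proof
    assume k: "k \<le> rank A"
    obtain c where c: "c > 0" "\<And>B. norm (B - A) < c \<Longrightarrow> rank A \<le> rank B"
      using rank_lower_semicontinuous[OF A] by blast
    have "\<forall>B\<in>ball A c. k \<le> rank B"
      using c(2) k by (force simp: dist_norm norm_minus_commute)
    then show "A \<in> U k" using c(1) unfolding U_def by (intro UnionI[of "ball A c"]) auto
  qed (auto simp: U_def)
  have "{x\<in>space M. rank (Z x) = r} = {x\<in>space M. Z x \<in> U r \<and> Z x \<notin> U (Suc r)}"
    using U herm by (auto simp: not_less_eq_eq)
  moreover have "\<dots> \<in> sets M" by measurable
  ultimately show ?thesis by simp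
qed

section \<open>From the tail bounds to the limit of the probabilities\<close>

theorem mainTheorem19:
  fixes M :: "'a measure"
    and realcase :: bool
    and \<Theta> :: "nat \<Rightarrow> 'n::{finite,linorder} cmat"
    and d :: nat and \<alpha> :: "nat set"
    and Xbar :: "'n cmat"
    and \<omega> :: "nat \<Rightarrow> 'a \<Rightarrow> nat" and \<xi> :: "nat \<Rightarrow> 'a \<Rightarrow> real" and \<nu> :: real
    and \<rho> :: "nat \<Rightarrow> real" and \<gamma> :: "nat \<Rightarrow> 'a \<Rightarrow> real"
    and Xt :: "nat \<Rightarrow> 'a \<Rightarrow> 'n cmat" and Xhat :: "nat \<Rightarrow> 'a \<Rightarrow> 'n cmat"
    and f :: "(real, 'n) vec \<Rightarrow> (real, 'n) vec"
  defines "\<beta> \<equiv> {1..d} - \<alpha>"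
  assumes P: "prob_space M"
    \<comment> \<open>orthonormal basis of S^n, \<alpha> \<subseteq> {1..d}, Xbar fixed in S^n, PSD, rank \<ge> 1\<close>
    and basis: "orthonormal_basis realcase \<Theta> d"
    and alpha_sub: "\<alpha> \<subseteq> {1..d}"
    and Xbar_S: "Xbar \<in> Sn realcase" and Xbar_psd: "psd Xbar" and rank_pos: "rank Xbar \<ge> 1"
    \<comment> \<open>case (a) covariance/correlation completion, or case (b) density matrix completion\<close>
    and cases:
      "(inj_on \<Theta> {1..d} \<and> \<Theta> ` {1..d} = entry_basis realcase \<and>
         (\<exists>I. \<alpha> = {k\<in>{1..d}. \<exists>i\<in>I. \<Theta> k = unitmat i i} \<and> (\<forall>i\<in>I. Re (Xbar $ i $ i) > 0)))
       \<or> (\<not> realcase \<and> (\<exists>k0\<in>{1..d}. \<Theta> k0 = (1 / sqrt (real CARD('n))) *\<^sub>R mat 1 \<and> \<alpha> = {k0})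
          \<and> trace Xbar = 1)"
    \<comment> \<open>sampling: \<omega>_i i.i.d. uniform on \<beta>, \<xi>_i i.i.d. mean 0 variance 1, independent of the \<omega>_i\<close>
    and \<omega>_meas: "\<And>i. \<omega> i \<in> measurable M (count_space UNIV)"
    and \<omega>_in: "\<And>i. AE x in M. \<omega> i x \<in> \<beta>"
    and \<omega>_unif: "\<And>i k. k \<in> \<beta> \<Longrightarrow> measure M {x\<in>space M. \<omega> i x = k} = 1 / real (card \<beta>)"
    and \<omega>_indep: "prob_space.indep_vars M (\<lambda>_. count_space UNIV) \<omega> UNIV"
    and \<xi>_meas: "\<And>i. \<xi> i \<in> borel_measurable M"
    and \<xi>_indep: "prob_space.indep_vars M (\<lambda>_. borel) \<xi> UNIV"
    and \<xi>_ident: "\<And>i. distr M borel (\<xi> i) = distr M borel (\<xi> 0)"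
    and \<xi>_int: "integrable M (\<xi> 0)" and \<xi>_mean: "(\<integral>x. \<xi> 0 x \<partial>M) = 0"
    and \<xi>_sq_int: "integrable M (\<lambda>x. (\<xi> 0 x)\<^sup>2)" and \<xi>_var: "(\<integral>x. (\<xi> 0 x)\<^sup>2 \<partial>M) = 1"
    and \<omega>\<xi>_indep: "families_indep M \<omega> \<xi>"
    and \<nu>_pos: "\<nu> > 0"
    \<comment> \<open>tuning parameters\<close>
    and \<rho>_pos: "\<And>m. \<rho> m > 0"
    and \<rho>_lim: "\<rho> \<longlonglongrightarrow> 0"
    and \<rho>_rate: "filterlim (\<lambda>m. sqrt (real m) * \<rho> m) at_top sequentially"
    and \<gamma>_meas: "\<And>m. \<gamma> m \<in> borel_measurable M"
    and \<gamma>_nonneg: "\<And>m x. x \<in> space M \<Longrightarrow> \<gamma> m x \<ge> 0"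
    and \<gamma>_Op1: "bounded_in_prob M \<gamma>"
    \<comment> \<open>spectral operator F from a symmetric f with the stated sign/zero pattern\<close>
    and f_sym: "symmetric_fun f"
    and f_nonneg: "\<And>x i. (\<forall>j. x $ j \<ge> 0) \<Longrightarrow> f x $ i \<ge> 0"
    and f_zero: "\<And>x i. (\<forall>j. x $ j \<ge> 0) \<Longrightarrow> (f x $ i = 0 \<longleftrightarrow> x $ i = 0)"
    and F_cont: "continuous (at Xbar within {X \<in> Sn realcase. psd X}) (spectral_op f)"
    \<comment> \<open>initial estimator: PSD, consistent\<close>
    and Xt_meas: "\<And>m. Xt m \<in> borel_measurable M"
    and Xt_psd: "\<And>m x. x \<in> space M \<Longrightarrow> Xt m x \<in> Sn realcase \<and> psd (Xt m x)"
    and Xt_cons: "conv_in_prob M Xt Xbar"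
    \<comment> \<open>Xhat m is an optimal solution of (RC+) for every sample size m \<ge> 1 and outcome\<close>
    and Xhat_meas: "\<And>m. Xhat m \<in> borel_measurable M"
    and Xhat_opt: "\<And>m x. m \<ge> 1 \<Longrightarrow> x \<in> space M \<Longrightarrow>
        is_opt (rc_objective \<Theta> Xbar \<nu> (\<lambda>i. \<omega> i x) (\<lambda>i. \<xi> i x) m (\<rho> m) (\<gamma> m x)
                   (Xt m x) (spectral_op f (Xt m x)))
               (rc_feasible realcase \<Theta> \<alpha> Xbar) (Xhat m x)"
  shows "(\<lambda>m. measure M {x\<in>space M. rank (Xhat m x) = rank Xbar}) \<longlonglongrightarrow> 1"
proof -
  interpret prob_space M by (rule P)
  have herm: "hermitian Xbar" using Xbar_S by (simp add: Sn_def)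
  let ?F = "spectral_op f"
  have fin: "finite \<beta>" by (simp add: \<beta>_def)
  obtain \<delta> where \<delta>: "\<delta> > 0" "correctable realcase \<Theta> \<alpha> Xbar (?F Xbar) \<delta>"
    using exists_correction[OF Xbar_psd f_nonneg f_zero cases] by blast
  have \<beta>_eq: "\<beta> = {1..d} - \<alpha>" by (simp add: \<beta>_def)
  from rank_consistent_on_good_event[OF basis alpha_sub \<beta>_eq Xbar_S Xbar_psd \<nu>_pos \<delta>(2,1)]
  obtain \<eta> where eta: "\<eta> > 0" and good: "\<And>m w z r g Xt G X. (\<And>i. w i \<in> \<beta>) \<Longrightarrow>
      (\<And>k. k \<in> \<beta> \<Longrightarrow> \<bar>slot_avg w m (\<lambda>_. 1) k - 1 / real (card \<beta>)\<bar> \<le> \<eta>) \<Longrightarrow>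
      (\<And>k. k \<in> \<beta> \<Longrightarrow> \<bar>slot_avg w m z k\<bar> \<le> \<eta> * r) \<Longrightarrow> r > 0 \<Longrightarrow> r \<le> \<eta> \<Longrightarrow> g \<ge> 0 \<Longrightarrow> g * r \<le> \<eta> \<Longrightarrow>
      norm (G - ?F Xbar) \<le> \<eta> \<Longrightarrow> g * norm (Xt - Xbar) \<le> \<eta> \<Longrightarrow>
      is_opt (rc_objective \<Theta> Xbar \<nu> w z m r g Xt G) (rc_feasible realcase \<Theta> \<alpha> Xbar) X \<Longrightarrow>
      rank X = rank Xbar"
    by metis
  define R where "R m = {x\<in>space M. rank (Xhat m x) = rank Xbar}" for m
  define A1 where "A1 m k = {x\<in>space M. \<bar>slot_avg (\<lambda>i. \<omega> i x) m (\<lambda>_. 1) k - 1 / real (card \<beta>)\<bar> > \<eta>}" for m k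
  define A2 where "A2 m k = {x\<in>space M. \<bar>slot_avg (\<lambda>i. \<omega> i x) m (\<lambda>i. \<xi> i x) k\<bar> > \<eta> * \<rho> m}" for m k
  note [measurable] = \<omega>_meas \<xi>_meas \<gamma>_meas Xt_meas
  have A_meas[measurable]: "A1 m k \<in> sets M" "A2 m k \<in> sets M" for m k
    unfolding A1_def A2_def slot_avg_def by measurable
  have R_meas: "R m \<in> sets M" if "m \<ge> 1" for m
    unfolding R_def using Xhat_opt[OF that]
    by (intro rank_level_set_measurable Xhat_meas) (auto simp: is_opt_def rc_feasible_def Sn_def)
  have A1_tail: "prob (A1 m k) \<le> 1 / (real m * \<eta>\<^sup>2)" if "m \<ge> 1" "k \<in> \<beta>" for m k
    unfolding A1_def by (rule slot_frequency_tail[OF \<omega>_indep \<omega>_unif[OF that(2)] that(1) eta])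
  have A2_tail: "prob (A2 m k) \<le> 1 / (real m * (\<eta> * \<rho> m)\<^sup>2)" if "m \<ge> 1" for m k
    unfolding A2_def
    by (rule slot_noise_tail[OF \<omega>_meas \<xi>_indep \<xi>_ident \<xi>_int \<xi>_mean \<xi>_sq_int \<xi>_var \<omega>\<xi>_indep that])
      (use eta \<rho>_pos in simp)
  have lim1: "(\<lambda>m. 1 / (real m * \<eta>\<^sup>2)) \<longlonglongrightarrow> 0"
  proof -
    have "(\<lambda>m. inverse (real m) * (1 / \<eta>\<^sup>2)) \<longlonglongrightarrow> 0 * (1 / \<eta>\<^sup>2)"
      by (intro tendsto_intros lim_inverse_n)
    then show ?thesis by (simp add: divide_simps)
  qed
  \<comment> \<open>The growth of \<open>sqrt (real m) * \<rho> m\<close> enters here: the noise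
    must be small relative to \<open>\<rho> m\<close>.\<close>
  have lim2: "(\<lambda>m. 1 / (real m * (\<eta> * \<rho> m)\<^sup>2)) \<longlonglongrightarrow> 0"
  proof -
    have "(\<lambda>m. (inverse (sqrt (real m) * \<rho> m))\<^sup>2 * (1 / \<eta>\<^sup>2)) \<longlonglongrightarrow> 0\<^sup>2 * (1 / \<eta>\<^sup>2)"
      by (intro tendsto_intros tendsto_inverse_0_at_top \<rho>_rate)
    moreover have "(inverse (sqrt (real m) * \<rho> m))\<^sup>2 * (1 / \<eta>\<^sup>2) = 1 / (real m * (\<eta> * \<rho> m)\<^sup>2)" for m
      by (simp add: power_mult_distrib power_inverse divide_inverse mult_ac)
    ultimately show ?thesis by simp
  qed
  have sampling: "AE x in M. \<forall>i. \<omega> i x \<in> \<beta>" using \<omega>_in by (simp add: AE_all_countable)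
  have main: "\<forall>\<^sub>F m in sequentially. 1 - e < prob (R m)" if e: "e > 0" for e
  proof -
    \<comment> \<open>Boundedness in probability gives no limit, only a bound below a prescribed
      level; half of \<open>e\<close> is reserved for it and half for the vanishing tails.\<close>
    obtain K0 N where K0: "\<And>m. m \<ge> N \<Longrightarrow> prob {x\<in>space M. \<bar>\<gamma> m x\<bar> > K0} < e / 2"
      using \<gamma>_Op1 e unfolding bounded_in_prob_def by (meson half_gt_zero)
    define K where "K = \<bar>K0\<bar> + 1"
    have K: "K > 0" "K0 \<le> K" by (auto simp: K_def)
    define A3 where "A3 m = {x\<in>space M. \<bar>\<gamma> m x\<bar> > K}" for m
    have [measurable]: "A3 m \<in> sets M" for m unfolding A3_def by measurable
    have A3_tail: "prob (A3 m) < e / 2" if "m \<ge> N" for m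
    proof -
      have "prob (A3 m) \<le> prob {x\<in>space M. \<bar>\<gamma> m x\<bar> > K0}"
        unfolding A3_def using K(2) by (intro finite_measure_mono) auto
      then show ?thesis using K0[OF that] by linarith
    qed
    obtain s where s: "s > 0" and F_near: "\<And>X. X \<in> Sn realcase \<Longrightarrow> psd X \<Longrightarrow> norm (X - Xbar) < s \<Longrightarrow> norm (?F X - ?F Xbar) < \<eta>"
      using F_cont eta unfolding continuous_within_eps_delta by (force simp: dist_norm)
    \<comment> \<open>Half of \<open>s\<close> gives strict closeness for continuity of the spectral
      operator at \<open>Xbar\<close>; \<open>\<eta> / K\<close> controls the proximal term.\<close>
    define t where "t = min (s / 2) (\<eta> / K)"
    have t: "t > 0" "t < s" "K * t \<le> \<eta>"
      using s eta K by (auto simp: t_def min_def field_simps)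
    define A4 where "A4 m = {x\<in>space M. frob (Xt m x - Xbar) > t}" for m
    have [measurable]: "A4 m \<in> sets M" for m unfolding A4_def frob_eq_norm by measurable
    have A4_lim: "(\<lambda>m. prob (A4 m)) \<longlonglongrightarrow> 0"
      using Xt_cons t(1) unfolding conv_in_prob_def A4_def by blast
    define bad where "bad m = (\<Union>k\<in>\<beta>. A1 m k) \<union> (\<Union>k\<in>\<beta>. A2 m k) \<union> A3 m \<union> A4 m" for m
    have bad_meas[measurable]: "bad m \<in> sets M" for m
      unfolding bad_def using fin by (intro sets.Un sets.finite_UN) auto
    \<comment> \<open>The inclusion holds only almost everywhere, since the sampled indices lie in
      \<open>\<beta>\<close> almost surely.\<close>
    have R_good: "AE x in M. x \<notin> bad m \<longrightarrow> x \<in> R m" if m: "m \<ge> 1" and r: "\<rho> m \<le> \<eta>" "K * \<rho> m \<le> \<eta>" for m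
      using sampling AE_space
    proof eventually_elim
      case (elim x)
      show ?case
      proof
        assume nb: "x \<notin> bad m"
        have x: "x \<in> space M" by (rule elim(2))
        have g: "0 \<le> \<gamma> m x" "\<gamma> m x \<le> K" using nb \<gamma>_nonneg[OF x] x by (auto simp: bad_def A3_def)
        have Xt: "norm (Xt m x - Xbar) \<le> t" using nb x by (auto simp: bad_def A4_def frob_eq_norm)
        have "rank (Xhat m x) = rank Xbar"
        proof (rule good[OF _ _ _ \<rho>_pos r(1) g(1) _ _ _ Xhat_opt[OF m x]])
          show "\<omega> i x \<in> \<beta>" for i using elim(1) by blast
          show "\<bar>slot_avg (\<lambda>i. \<omega> i x) m (\<lambda>_. 1) k - 1 / real (card \<beta>)\<bar> \<le> \<eta>" if "k \<in> \<beta>" for k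
            using nb that x by (auto simp: bad_def A1_def not_less)
          show "\<bar>slot_avg (\<lambda>i. \<omega> i x) m (\<lambda>i. \<xi> i x) k\<bar> \<le> \<eta> * \<rho> m" if "k \<in> \<beta>" for k
            using nb that x by (auto simp: bad_def A2_def not_less)
          have "\<gamma> m x * \<rho> m \<le> K * \<rho> m" using g \<rho>_pos[of m] by (intro mult_right_mono) auto
          then show "\<gamma> m x * \<rho> m \<le> \<eta>" using r(2) by linarith
          show "norm (?F (Xt m x) - ?F Xbar) \<le> \<eta>"
            using F_near[of "Xt m x"] Xt_psd[OF x] Xt t(2) by force
          have "\<gamma> m x * norm (Xt m x - Xbar) \<le> K * t" using g Xt t by (intro mult_mono) auto
          then show "\<gamma> m x * norm (Xt m x - Xbar) \<le> \<eta>" using t(3) by linarith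
        qed
        then show "x \<in> R m" using x by (simp add: R_def)
      qed
    qed
    define tail where "tail m = real (card \<beta>) * (1 / (real m * \<eta>\<^sup>2)) + real (card \<beta>) * (1 / (real m * (\<eta> * \<rho> m)\<^sup>2)) + prob (A4 m)" for m
    have tail_lim: "tail \<longlonglongrightarrow> real (card \<beta>) * 0 + real (card \<beta>) * 0 + 0"
      unfolding tail_def by (intro tendsto_intros lim1 lim2 A4_lim)
    then have "\<forall>\<^sub>F m in sequentially. tail m < e / 2"
      using e by (intro order_tendstoD(2)[OF tail_lim]) simp
    \<comment> \<open>The second bound turns \<open>\<gamma> m x \<le> K\<close> into
      \<open>\<gamma> m x * \<rho> m \<le> \<eta>\<close>.\<close>
    moreover have "\<forall>\<^sub>F m in sequentially. \<rho> m < min \<eta> (\<eta> / K)"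
      using eta K by (intro order_tendstoD(2)[OF \<rho>_lim]) simp
    moreover have "\<forall>\<^sub>F m in sequentially. m \<ge> max 1 N" by (rule eventually_ge_at_top)
    ultimately show ?thesis
    proof eventually_elim
      case (elim m)
      have m: "m \<ge> 1" "m \<ge> N" using elim(3) by auto
      have r: "\<rho> m \<le> \<eta>" "K * \<rho> m \<le> \<eta>" using elim(2) K by (auto simp: field_simps)
      have "prob (bad m) \<le> prob (\<Union>k\<in>\<beta>. A1 m k) + prob (\<Union>k\<in>\<beta>. A2 m k) + prob (A3 m) + prob (A4 m)"
        unfolding bad_def using fin
        by (intro order_trans[OF measure_Un_le] add_right_mono) (auto intro!: sets.finite_UN sets.Un)
      also have "prob (\<Union>k\<in>\<beta>. A1 m k) \<le> (\<Sum>k\<in>\<beta>. prob (A1 m k))"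
        using fin by (intro finite_measure_subadditive_finite) auto
      also have "(\<Sum>k\<in>\<beta>. prob (A1 m k)) \<le> (\<Sum>k\<in>\<beta>. 1 / (real m * \<eta>\<^sup>2))"
        using A1_tail[OF m(1)] by (intro sum_mono)
      also have "prob (\<Union>k\<in>\<beta>. A2 m k) \<le> (\<Sum>k\<in>\<beta>. prob (A2 m k))"
        using fin by (intro finite_measure_subadditive_finite) auto
      also have "(\<Sum>k\<in>\<beta>. prob (A2 m k)) \<le> (\<Sum>k\<in>\<beta>. 1 / (real m * (\<eta> * \<rho> m)\<^sup>2))"
        using A2_tail[OF m(1)] by (intro sum_mono)
      finally have "prob (bad m) \<le> tail m + prob (A3 m)" by (simp add: tail_def)
      then have "prob (bad m) < e" using elim(1) A3_tail[OF m(2)] by linarith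
      moreover have "prob (space M - bad m) \<le> prob (R m)"
        using R_good[OF m(1) r] by (intro finite_measure_mono_AE R_meas m) auto
      ultimately show "1 - e < prob (R m)" by (simp add: prob_compl)
    qed
  qed
  have "(\<lambda>m. prob (R m)) \<longlonglongrightarrow> 1"
  proof (rule order_tendstoI)
    show "\<forall>\<^sub>F m in sequentially. a < prob (R m)" if "a < 1" for a
      using main[of "1 - a"] that by simp
    show "\<forall>\<^sub>F m in sequentially. prob (R m) < a" if "1 < a" for a
      using that by (intro always_eventually allI) (auto intro: le_less_trans[OF prob_le_1])
  qed
  then show ?thesis by (simp add: R_def)
qed

end
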